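(* Let $p\ge 0$, $C_A\ge 1$, $\beta\ge 0$, $R>0$, and assume $C_A^{-1}i^{-p}\le\lambda_i\le C_Ai^{-p}$ for $1\le i\le D$. Let $\tau$ be any $\mathcal G$-stopping time. If there exists $\mu\in H^\beta(R,D)$ with $\mathcal R(\mu,\tau)\le C_\mu\,\mathcal R^*_{\beta,p,R}(\delta)$, then for any $\alpha\in[0,\beta]$ and $\bar R\ge 2R$ there exists $\bar\mu\in H^\alpha(\bar R,D)$ such that $$\mathcal R(\bar\mu,\tau)\ge c_1\,\bar R\,\min\Big(\big(\bar R^{-1}\delta D^{1/4}\big)^{2\alpha/(2\alpha+2p)},\ (R^{-1}\delta)^{2\alpha/(2\beta+2p+1)}\Big),$$ provided $R^{-1}\delta\le c_2$ and $D\ge c_3\,t_{\alpha-\frac14,p,\bar R}(\delta)$. The constants $c_1,c_3>0$ and $c_2\in(0,1]$ depend only on $C_\mu,C_A,\alpha,p$.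
   Context: Model: $D\ge 1$ is an integer, $\delta>0$, $\lambda_1\ge\cdots\ge\lambda_D>0$ are known, and for a signal $\mu\in\mathbb{R}^D$ one observes $Y_i=\lambda_i\mu_i+\delta\varepsilon_i$, $i=1,\ldots,D$, with $\varepsilon_i$ independent $N(0,1)$; $\mathbb{E}_\mu$ is expectation under signal $\mu$. Truncated SVD estimators: $\widehat\mu^{(m)}_i=\mathbf 1(i\le m)\lambda_i^{-1}Y_i$, $0\le m\le D$. $\|\cdot\|$ is the Euclidean norm. Residual filtration: $\mathcal G_m=\sigma(Y_1,\ldots,Y_m)\vee\sigma(\|Y\|^2)$, $0\le m\le D$. A $\mathcal G$-stopping time (rule) is a stopping time $\tau$ with respect to $(\mathcal G_m)_{0\le m\le D}$ with values in $\{0,\ldots,D\}$ (a fixed function of the data, the same for all signals). $\mathcal R(\mu,\tau)=\mathbb{E}_\mu[\|\widehat\mu^{(\tau)}-\mu\|^2]^{1/2}$. Sobolev-type ellipsoids: $H^\beta(R,D)=\{\mu\in\mathbb{R}^D:\sum_{i=1}^Di^{2\beta}\mu_i^2\le R^2\}$. Notation: $t_{\beta,p,R}(\delta)=(R^{-1}\delta)^{-2/(2\beta+2p+1)}$, so that $t_{\alpha-\frac14,p,\bar R}(\delta)=(\bar R^{-1}\delta)^{-2/(2\alpha+2p+1/2)}$; $\mathcal R^*_{\beta,p,R}(\delta)=R(R^{-1}\delta)^{2\beta/(2\beta+2p+1)}$. *)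

theory Defs
  imports "HOL-Probability.Probability"
begin

text \<open>
  Vectors in \<open>R^D\<close>, with components indexed by \<open>1, ..., D\<close>, are the extensional functions
  in \<open>{1..D} \<rightarrow>\<^sub>E UNIV\<close>: the dimension is then a natural number that can be quantified over.
  \<open>L2_set x {1..D}\<close> is the Euclidean norm of \<open>x\<close>. The singular values are written \<open>lam\<close>.
\<close>

definition data_space :: "nat \<Rightarrow> (nat \<Rightarrow> real) measure" where
  "data_space D = Pi\<^sub>M {1..D} (\<lambda>_. borel)"

definition noise :: "nat \<Rightarrow> (nat \<Rightarrow> real) measure" where
  "noise D = Pi\<^sub>M {1..D} (\<lambda>_. density lborel (\<lambda>x. ennreal (std_normal_density x)))"

text \<open>
  The law of the observation \<open>Y\<close> under the signal \<open>\<mu>\<close>. Expectation under \<open>\<mu>\<close> is integration with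
  respect to this measure on the data space; a rule is a function on the data space and hence
  does not depend on the signal.
\<close>

definition obs_law ::
  "nat \<Rightarrow> real \<Rightarrow> (nat \<Rightarrow> real) \<Rightarrow> (nat \<Rightarrow> real) \<Rightarrow> (nat \<Rightarrow> real) measure" where
  "obs_law D \<delta> lam \<mu> =
     distr (noise D) (data_space D) (\<lambda>\<epsilon>. \<lambda>i\<in>{1..D}. lam i * \<mu> i + \<delta> * \<epsilon> i)"

definition tsvd :: "(nat \<Rightarrow> real) \<Rightarrow> nat \<Rightarrow> (nat \<Rightarrow> real) \<Rightarrow> nat \<Rightarrow> real" where
  "tsvd lam m y i = (if i \<le> m then inverse (lam i) * y i else 0)"

text \<open>
  \<open>\<sigma>(Y\<^sub>1, ..., Y\<^sub>m) \<or> \<sigma>(\<parallel>Y\<parallel>\<^sup>2)\<close> on the data space, for \<open>0 \<le> m \<le> D\<close>. Since the library's stopping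
  times are indexed by a whole type, the filtration is continued constantly for \<open>m > D\<close>; for
  rules with values in \<open>{0..D}\<close> the times \<open>m > D\<close> impose no condition.
\<close>

definition residual_filtration :: "nat \<Rightarrow> nat \<Rightarrow> (nat \<Rightarrow> real) measure" where
  "residual_filtration D m =
     (let \<Omega> = space (data_space D) in
      sigma \<Omega>
        ((\<Union>i\<in>{1..min m D}. sets (vimage_algebra \<Omega> (\<lambda>y. y i) borel)) \<union>
         sets (vimage_algebra \<Omega> (\<lambda>y. (L2_set y {1..D})\<^sup>2) borel)))"

definition residual_rule :: "nat \<Rightarrow> ((nat \<Rightarrow> real) \<Rightarrow> nat) \<Rightarrow> bool" where
  "residual_rule D \<tau> \<longleftrightarrow>
     stopping_time (residual_filtration D) \<tau> \<and> (\<forall>y\<in>space (data_space D). \<tau> y \<le> D)"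

definition risk ::
  "nat \<Rightarrow> real \<Rightarrow> (nat \<Rightarrow> real) \<Rightarrow> (nat \<Rightarrow> real) \<Rightarrow> ((nat \<Rightarrow> real) \<Rightarrow> nat) \<Rightarrow> real" where
  "risk D \<delta> lam \<mu> \<tau> =
     sqrt (\<integral>y. (L2_set (\<lambda>i. tsvd lam (\<tau> y) y i - \<mu> i) {1..D})\<^sup>2 \<partial>obs_law D \<delta> lam \<mu>)"

definition sobolev_ellipsoid :: "real \<Rightarrow> real \<Rightarrow> nat \<Rightarrow> (nat \<Rightarrow> real) set" where
  "sobolev_ellipsoid \<beta> R D =
     {\<mu> \<in> {1..D} \<rightarrow>\<^sub>E UNIV. (\<Sum>i=1..D. real i powr (2 * \<beta>) * (\<mu> i)\<^sup>2) \<le> R\<^sup>2}"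

definition time_scale :: "real \<Rightarrow> real \<Rightarrow> real \<Rightarrow> real \<Rightarrow> real" where
  "time_scale \<beta> p R \<delta> = (inverse R * \<delta>) powr (- 2 / (2 * \<beta> + 2 * p + 1))"

definition minimax_rate :: "real \<Rightarrow> real \<Rightarrow> real \<Rightarrow> real \<Rightarrow> real" where
  "minimax_rate \<beta> p R \<delta> = R * (inverse R * \<delta>) powr (2 * \<beta> / (2 * \<beta> + 2 * p + 1))"

lemma space_data_space: "space (data_space D) = {1..D} \<rightarrow>\<^sub>E UNIV"
  by (simp add: data_space_def space_PiM)

lemma sets_vimage_algebra_subset: "sets (vimage_algebra \<Omega> f M) \<subseteq> Pow \<Omega>"
  by (metis sets.space_closed space_vimage_algebra)

lemma filtration_residual_filtration:
  "filtration (space (data_space D)) (residual_filtration D)"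
proof
  define G where "G m = (\<Union>i\<in>{1..min m D}.
      sets (vimage_algebra (space (data_space D)) (\<lambda>y. y i) (borel :: real measure))) \<union>
      sets (vimage_algebra (space (data_space D)) (\<lambda>y. (L2_set y {1..D})\<^sup>2) borel)" for m
  have G: "G m \<subseteq> Pow (space (data_space D))" for m
    using sets_vimage_algebra_subset unfolding G_def by blast
  have eq: "residual_filtration D m = sigma (space (data_space D)) (G m)" for m
    by (simp add: residual_filtration_def G_def Let_def)
  show "space (residual_filtration D m) = space (data_space D)" for m
    by (simp add: eq G space_measure_of_conv)
  show "sets (residual_filtration D m) \<subseteq> sets (residual_filtration D n)" if "m \<le> n" for m n
  proof -
    have "{1..min m D} \<subseteq> {1..min n D}"
      using that by auto
    then have "G m \<subseteq> G n"
      unfolding G_def by blast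
    then show ?thesis
      by (simp add: eq sets_measure_of[OF G] sigma_sets_mono')
  qed
qed

lemma prob_space_obs_law: "prob_space (obs_law D \<delta> lam \<mu>)"
proof -
  interpret product_prob_space "\<lambda>_. density lborel (\<lambda>x. ennreal (std_normal_density x))" "{1..D}"
    by (intro product_prob_spaceI prob_space_normal_density) simp
  have "prob_space (noise D)"
    unfolding noise_def by unfold_locales
  moreover have "(\<lambda>\<epsilon>. \<lambda>i\<in>{1..D}. lam i * \<mu> i + \<delta> * \<epsilon> i) \<in> noise D \<rightarrow>\<^sub>M data_space D"
    unfolding noise_def data_space_def by measurable
  ultimately show ?thesis
    unfolding obs_law_def by (rule prob_space.prob_space_distr)
qed

end

theory Submission
  imports Defs
begin

text \<open>
  A rule that sees only \<open>Y\<^sub>1, ..., Y\<^sub>m\<^sub>-\<^sub>1\<close> and \<open>\<parallel>Y\<parallel>\<^sup>2\<close> can detect signal in the coordinates \<open>i \<ge> m\<close> only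
  through the energy \<open>\<Sum>i\<ge>m. Y\<^sub>i\<^sup>2\<close>. The noise makes this energy fluctuate by order \<open>\<surd>(D - m) \<delta>\<^sup>2\<close>, so
  a change of \<open>\<Sum>i\<ge>m. \<lambda>\<^sub>i\<^sup>2\<mu>\<^sub>i\<^sup>2\<close> below that order is invisible, even if it is a single spike at
  coordinate \<open>m\<close>.

  Accuracy at \<open>\<mu>\<close> forces early stopping: on \<open>{\<tau> \<ge> m}\<close> the loss contains the noise
  \<open>\<delta>\<^sup>2 \<Sum>i\<le>m. \<lambda>\<^sub>i\<^sup>-\<^sup>2\<epsilon>\<^sub>i\<^sup>2\<close>, so a small risk and a large variance \<open>\<delta>\<^sup>2 \<Sum>i\<le>m. \<lambda>\<^sub>i\<^sup>-\<^sup>2\<close> make this event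
  unlikely (\<open>noise_energy_on_event\<close>). If \<open>\<mu>'\<close> differs from \<open>\<mu>\<close> by an invisible spike at \<open>m\<close>, the event
  stays unlikely under \<open>\<mu>'\<close> (\<open>shifted_mean_energy_perturbation\<close>); off it the spike is truncated, and
  the loss is at least \<open>\<mu>'\<^sub>m\<^sup>2\<close>. Together this is \<open>risk_lower_bound\<close>.

  Invisibility is proved without the noncentral \<open>\<chi>\<^sup>2\<close> density. The probability of the event depends on
  the coordinates \<open>i \<ge> m\<close> of the mean only through their norm, because the Gaussian law is rotation
  invariant. Therefore the spike may be replaced by equal shifts of the \<open>D - m\<close> coordinates beyond
  \<open>m\<close>, and symmetrising their signs gives a product likelihood ratio whose second moment is
  \<open>cosh (h\<^sup>2 / (D - m)) ^ (D - m)\<close> when the energy grows by \<open>(\<delta> h)\<^sup>2\<close>; this is bounded as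
  long as \<open>h\<^sup>4\<close> is at most of order \<open>D - m\<close>.

  The level \<open>m\<close> is of the order of the larger of two numbers (\<open>truncation_level\<close>): a multiple of
  \<open>(R\<^sup>-\<^sup>1\<delta>) powr (- 2 / (2\<beta> + 2p + 1))\<close>, beyond which the variance exceeds the assumed risk, and
  \<open>(R'\<^sup>-\<^sup>1\<delta>D powr (1/4)) powr (- 1 / (\<alpha> + p))\<close>, beyond which a spike of the maximal size \<open>R' m powr (- \<alpha>)\<close>
  in the ellipsoid is invisible. The two terms of the minimum correspond to these two cases.
\<close>

section \<open>Gaussian integrals on the line and in the plane\<close>

abbreviation std_normal :: "real measure" where
  "std_normal \<equiv> density lborel (\<lambda>x. ennreal (std_normal_density x))"

lemma nn_integral_lborel_translate:
  fixes g :: "real \<Rightarrow> ennreal"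
  assumes "g \<in> borel_measurable borel"
  shows "(\<integral>\<^sup>+x. g (t + x) \<partial>lborel) = (\<integral>\<^sup>+x. g x \<partial>lborel)"
  using nn_integral_real_affine[of g 1 t] assms by simp

lemma std_normal_shift:
  assumes [measurable]: "g \<in> borel_measurable borel"
  shows "(\<integral>\<^sup>+x. g (a + x) \<partial>std_normal) = (\<integral>\<^sup>+x. g x * ennreal (exp (a * x - a\<^sup>2 / 2)) \<partial>std_normal)"
proof -
  have dens: "std_normal_density (x - a) = std_normal_density x * exp (a * x - a\<^sup>2 / 2)" for x
    by (simp add: std_normal_density_def exp_add[symmetric] power2_eq_square field_simps)
  have "(\<integral>\<^sup>+x. g (a + x) \<partial>std_normal)
      = (\<integral>\<^sup>+x. ennreal (std_normal_density (a + x - a)) * g (a + x) \<partial>lborel)"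
    by (simp add: nn_integral_density)
  also have "\<dots> = (\<integral>\<^sup>+x. ennreal (std_normal_density (x - a)) * g x \<partial>lborel)"
    by (rule nn_integral_lborel_translate) measurable
  also have "\<dots> = (\<integral>\<^sup>+x. g x * ennreal (exp (a * x - a\<^sup>2 / 2)) \<partial>std_normal)"
    by (simp add: nn_integral_density dens ennreal_mult mult_ac)
  finally show ?thesis .
qed

lemma std_normal_reflect:
  assumes [measurable]: "g \<in> borel_measurable borel"
  shows "(\<integral>\<^sup>+x. g (- x) \<partial>std_normal) = (\<integral>\<^sup>+x. g x \<partial>std_normal)"
proof -
  have "(\<integral>\<^sup>+x. g (- x) \<partial>std_normal) = (\<integral>\<^sup>+x. ennreal (std_normal_density (- x)) * g (- x) \<partial>lborel)"
    by (simp add: nn_integral_density std_normal_density_def)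
  also have "\<dots> = (\<integral>\<^sup>+x. ennreal (std_normal_density x) * g x \<partial>lborel)"
    using nn_integral_real_affine[of "\<lambda>x. ennreal (std_normal_density x) * g x" "-1" 0] by simp
  finally show ?thesis by (simp add: nn_integral_density)
qed

lemma prob_space_std_normal: "prob_space std_normal"
  by (rule prob_space_normal_density) simp

lemma nn_integral_exp_std_normal:
  "(\<integral>\<^sup>+x. ennreal (exp (a * x)) \<partial>std_normal) = ennreal (exp (a\<^sup>2 / 2))"
proof -
  have "1 = (\<integral>\<^sup>+x. ennreal (exp (a * x - a\<^sup>2 / 2)) \<partial>std_normal)"
    using std_normal_shift[of "\<lambda>_. 1" a] prob_space.emeasure_space_1[OF prob_space_std_normal] by simp
  then have "ennreal (exp (a\<^sup>2 / 2)) = ennreal (exp (a\<^sup>2 / 2)) * (\<integral>\<^sup>+x. ennreal (exp (a * x - a\<^sup>2 / 2)) \<partial>std_normal)"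
    by simp
  also have "\<dots> = (\<integral>\<^sup>+x. ennreal (exp (a * x)) \<partial>std_normal)"
    by (subst nn_integral_cmult[symmetric]) (auto simp: ennreal_mult[symmetric] exp_add[symmetric])
  finally show ?thesis by simp
qed

text \<open>
  The average over both signs of the likelihood ratio of \<open>N(\<plusminus>k, 1)\<close> to \<open>N(0, 1)\<close>.
\<close>

definition tilt :: "real \<Rightarrow> real \<Rightarrow> real" where
  "tilt k x = cosh (k * x) * exp (- k\<^sup>2 / 2)"

lemma tilt_measurable [measurable]: "tilt k \<in> borel_measurable borel"
  unfolding tilt_def cosh_field_def by measurable

lemma tilt_nonneg: "tilt k x \<ge> 0"
  by (simp add: tilt_def cosh_real_nonneg)

text \<open>
  For an even integrand the means \<open>k\<close> and \<open>- k\<close> give the same integral, so the likelihood ratio of the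
  shift may be averaged over the two signs. The average is \<open>1\<close> up to terms of second order in \<open>k\<close>, whereas
  the unsymmetrised ratio deviates from \<open>1\<close> at first order.
\<close>

lemma std_normal_shift_even:
  assumes [measurable]: "g \<in> borel_measurable borel" and even: "\<And>x. g (- x) = g x"
  shows "(\<integral>\<^sup>+x. g (k + x) \<partial>std_normal) = (\<integral>\<^sup>+x. g x * ennreal (tilt k x) \<partial>std_normal)"
proof -
  have half: "0 \<le> (1/2 :: real)" by simp
  define A where "A = (\<integral>\<^sup>+x. g (k + x) \<partial>std_normal)"
  have p: "A = (\<integral>\<^sup>+x. g x * ennreal (exp (k * x - k\<^sup>2 / 2)) \<partial>std_normal)"
    unfolding A_def by (rule std_normal_shift) simp
  also have "\<dots> = (\<integral>\<^sup>+x. g (- x) * ennreal (exp (k * (- x) - k\<^sup>2 / 2)) \<partial>std_normal)"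
    by (rule std_normal_reflect[symmetric]) measurable
  finally have m: "A = (\<integral>\<^sup>+x. g x * ennreal (exp (- (k * x) - k\<^sup>2 / 2)) \<partial>std_normal)"
    by (simp add: even)
  have "(\<integral>\<^sup>+x. g x * ennreal (tilt k x) \<partial>std_normal)
      = (\<integral>\<^sup>+x. g x * ennreal (exp (k * x - k\<^sup>2 / 2)) * ennreal (1/2)
             + g x * ennreal (exp (- (k * x) - k\<^sup>2 / 2)) * ennreal (1/2) \<partial>std_normal)"
  proof (rule nn_integral_cong)
    fix x
    have "tilt k x = exp (k * x - k\<^sup>2 / 2) * (1/2) + exp (- (k * x) - k\<^sup>2 / 2) * (1/2)"
      by (simp add: tilt_def cosh_field_def distrib_right exp_add[symmetric] add_divide_distrib)
    then have "ennreal (tilt k x) = ennreal (exp (k * x - k\<^sup>2 / 2)) * ennreal (1/2) + ennreal (exp (- (k * x) - k\<^sup>2 / 2)) * ennreal (1/2)"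
      by (simp only: ennreal_plus ennreal_mult exp_ge_zero mult_nonneg_nonneg zero_le_divide_1_iff zero_le_numeral)
    then show "g x * ennreal (tilt k x) = g x * ennreal (exp (k * x - k\<^sup>2 / 2)) * ennreal (1/2)
             + g x * ennreal (exp (- (k * x) - k\<^sup>2 / 2)) * ennreal (1/2)"
      by (simp add: distrib_left mult.assoc)
  qed
  also have "\<dots> = A * ennreal (1/2) + A * ennreal (1/2)"
    by (subst nn_integral_add) (simp_all add: nn_integral_multc p[symmetric] m[symmetric])
  also have "\<dots> = A * (ennreal (1/2) + ennreal (1/2))"
    by (simp only: distrib_left)
  also have "ennreal (1/2) + ennreal (1/2) = 1"
    unfolding ennreal_plus[OF half half, symmetric] by simp
  finally show ?thesis by (simp add: A_def)
qed

lemma nn_integral_tilt_square: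
  "(\<integral>\<^sup>+x. ennreal ((tilt k x)\<^sup>2) \<partial>std_normal) = ennreal (cosh (k\<^sup>2))"
proof -
  have "(tilt k x)\<^sup>2 = exp (- k\<^sup>2) / 4 * exp ((2 * k) * x)
          + exp (- k\<^sup>2) / 4 * exp ((- 2 * k) * x) + exp (- k\<^sup>2) / 2" for x
  proof -
    have "(tilt k x)\<^sup>2 = ((exp (k * x))\<^sup>2 + (exp (- (k * x)))\<^sup>2 + 2 * (exp (k * x) * exp (- (k * x)))) / 4
        * (exp (- k\<^sup>2 / 2))\<^sup>2"
      by (simp add: tilt_def cosh_field_def power_mult_distrib power_divide power2_sum)
    then show ?thesis
      by (simp add: exp_double[symmetric] exp_add[symmetric] field_simps)
  qed
  then have "ennreal ((tilt k x)\<^sup>2) = ennreal (exp (- k\<^sup>2) / 4) * ennreal (exp ((2 * k) * x))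
          + ennreal (exp (- k\<^sup>2) / 4) * ennreal (exp ((- 2 * k) * x)) + ennreal (exp (- k\<^sup>2) / 2)" for x
    by (simp flip: ennreal_mult ennreal_plus)
  then have "(\<integral>\<^sup>+x. ennreal ((tilt k x)\<^sup>2) \<partial>std_normal)
      = ennreal (exp (- k\<^sup>2) / 4) * (\<integral>\<^sup>+x. ennreal (exp ((2 * k) * x)) \<partial>std_normal)
        + ennreal (exp (- k\<^sup>2) / 4) * (\<integral>\<^sup>+x. ennreal (exp ((- 2 * k) * x)) \<partial>std_normal)
        + ennreal (exp (- k\<^sup>2) / 2)"
    by (simp add: nn_integral_add nn_integral_cmult
         prob_space.emeasure_space_1[OF prob_space_std_normal, simplified])
  also have "\<dots> = ennreal (exp (- k\<^sup>2) / 4) * ennreal (exp ((2 * k)\<^sup>2 / 2)) + ennreal (exp (- k\<^sup>2) / 4) * ennreal (exp ((- 2 * k)\<^sup>2 / 2))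
        + ennreal (exp (- k\<^sup>2) / 2)"
    by (simp only: nn_integral_exp_std_normal)
  also have "\<dots> = ennreal (cosh (k\<^sup>2))"
    by (simp add: cosh_field_def power_mult_distrib exp_add[symmetric] add_divide_distrib
        flip: ennreal_mult ennreal_plus)
  finally show ?thesis .
qed

lemma nn_integral_lborel_shear:
  fixes F :: "real \<Rightarrow> real \<Rightarrow> ennreal"
  assumes [measurable]: "case_prod F \<in> borel_measurable (borel \<Otimes>\<^sub>M borel)"
  shows "(\<integral>\<^sup>+x. \<integral>\<^sup>+y. F x (y + s * x) \<partial>lborel \<partial>lborel) = (\<integral>\<^sup>+x. \<integral>\<^sup>+y. F x y \<partial>lborel \<partial>lborel)"
    and "(\<integral>\<^sup>+x. \<integral>\<^sup>+y. F (x + s * y) y \<partial>lborel \<partial>lborel) = (\<integral>\<^sup>+x. \<integral>\<^sup>+y. F x y \<partial>lborel \<partial>lborel)"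
proof -
  show "(\<integral>\<^sup>+x. \<integral>\<^sup>+y. F x (y + s * x) \<partial>lborel \<partial>lborel) = (\<integral>\<^sup>+x. \<integral>\<^sup>+y. F x y \<partial>lborel \<partial>lborel)"
  proof (rule nn_integral_cong)
    fix x
    show "(\<integral>\<^sup>+y. F x (y + s * x) \<partial>lborel) = (\<integral>\<^sup>+y. F x y \<partial>lborel)"
      using nn_integral_lborel_translate[of "F x" "s * x"] by (simp add: add.commute)
  qed
  have "(\<integral>\<^sup>+x. \<integral>\<^sup>+y. F (x + s * y) y \<partial>lborel \<partial>lborel) = (\<integral>\<^sup>+y. \<integral>\<^sup>+x. F (x + s * y) y \<partial>lborel \<partial>lborel)"
    by (rule lborel_pair.Fubini') measurable
  also have "\<dots> = (\<integral>\<^sup>+y. \<integral>\<^sup>+x. F x y \<partial>lborel \<partial>lborel)"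
  proof (rule nn_integral_cong)
    fix y
    show "(\<integral>\<^sup>+x. F (x + s * y) y \<partial>lborel) = (\<integral>\<^sup>+x. F x y \<partial>lborel)"
      using nn_integral_lborel_translate[of "\<lambda>x. F x y" "s * y"] by (simp add: add.commute)
  qed
  also have "\<dots> = (\<integral>\<^sup>+x. \<integral>\<^sup>+y. F x y \<partial>lborel \<partial>lborel)"
    by (rule lborel_pair.Fubini') measurable
  finally show "(\<integral>\<^sup>+x. \<integral>\<^sup>+y. F (x + s * y) y \<partial>lborel \<partial>lborel) = (\<integral>\<^sup>+x. \<integral>\<^sup>+y. F x y \<partial>lborel \<partial>lborel)" .
qed

text \<open>
  A rotation by an angle other than \<open>\<pi>\<close> is a product of three shears, and each shear preserves Lebesgue
  measure by Fubini and translation invariance.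
\<close>

lemma nn_integral_lborel_rotate:
  fixes F :: "real \<Rightarrow> real \<Rightarrow> ennreal"
  assumes [measurable]: "case_prod F \<in> borel_measurable (borel \<Otimes>\<^sub>M borel)"
    and cs: "c\<^sup>2 + s\<^sup>2 = 1" and c: "c \<noteq> -1"
  shows "(\<integral>\<^sup>+x. \<integral>\<^sup>+y. F (c * x - s * y) (s * x + c * y) \<partial>lborel \<partial>lborel)
       = (\<integral>\<^sup>+x. \<integral>\<^sup>+y. F x y \<partial>lborel \<partial>lborel)"
proof -
  \<comment> \<open>the tangent of half the rotation angle\<close>
  define t where "t = s / (1 + c)"
  have t1: "s * t = 1 - c"
  proof -
    have "s * s = (1 - c) * (1 + c)" using cs by (simp add: power2_eq_square algebra_simps)
    with c show ?thesis by (simp add: t_def field_simps)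
  qed
  have t2: "t + c * t = s"
    using c by (simp add: t_def add_divide_distrib[symmetric] field_simps)
  have eq: "F (c * x - s * y) (s * x + c * y)
      = F (x + (- t) * y + (- t) * (y + s * (x + (- t) * y))) (y + s * (x + (- t) * y))" for x y
  proof -
    have "y + s * (x + (- t) * y) = y + s * x - (s * t) * y"
      by (simp add: algebra_simps)
    then have "y + s * (x + (- t) * y) = s * x + c * y"
      by (simp add: t1 algebra_simps)
    moreover have "x + (- t) * y + (- t) * (s * x + c * y) = c * x - s * y"
    proof -
      have "x + (- t) * y + (- t) * (s * x + c * y) = x - (s * t) * x - (t + c * t) * y"
        by (simp add: algebra_simps)
      then show ?thesis unfolding t1 t2 by (simp add: algebra_simps)
    qed
    ultimately show ?thesis by simp
  qed
  have "(\<integral>\<^sup>+x. \<integral>\<^sup>+y. F (c * x - s * y) (s * x + c * y) \<partial>lborel \<partial>lborel)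
     = (\<integral>\<^sup>+x. \<integral>\<^sup>+y. F (x + (- t) * (y + s * x)) (y + s * x) \<partial>lborel \<partial>lborel)"
    unfolding eq
    by (rule nn_integral_lborel_shear(2)[of "\<lambda>x y. F (x + (- t) * (y + s * x)) (y + s * x)" "- t"]) measurable
  also have "\<dots> = (\<integral>\<^sup>+x. \<integral>\<^sup>+y. F (x + (- t) * y) y \<partial>lborel \<partial>lborel)"
    by (rule nn_integral_lborel_shear(1)[of "\<lambda>x y. F (x + (- t) * y) y" s]) measurable
  also have "\<dots> = (\<integral>\<^sup>+x. \<integral>\<^sup>+y. F x y \<partial>lborel \<partial>lborel)"
    by (rule nn_integral_lborel_shear(2)) measurable
  finally show ?thesis .
qed

text \<open>
  The density of \<open>N((a, b), 1)\<close> is a radial function times \<open>exp (a x + b y)\<close>. Rotating \<open>(a, b)\<close> to the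
  first axis turns the exponent into \<open>sqrt (a\<^sup>2 + b\<^sup>2) x\<close> and leaves the radial factors alone.
\<close>

lemma std_normal_radial:
  fixes g :: "real \<Rightarrow> real \<Rightarrow> ennreal"
  assumes meas[measurable]: "case_prod g \<in> borel_measurable (borel \<Otimes>\<^sub>M borel)"
    and radial: "\<And>x y x' y'. x\<^sup>2 + y\<^sup>2 = x'\<^sup>2 + y'\<^sup>2 \<Longrightarrow> g x y = g x' y'"
  shows "(\<integral>\<^sup>+x. \<integral>\<^sup>+y. g (a + x) (b + y) \<partial>std_normal \<partial>std_normal)
       = (\<integral>\<^sup>+x. \<integral>\<^sup>+y. g (sqrt (a\<^sup>2 + b\<^sup>2) + x) y \<partial>std_normal \<partial>std_normal)"
proof -
  interpret N: prob_space std_normal by (rule prob_space_std_normal)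
  define G where "G a b x y = g x y * ennreal (exp (- (x\<^sup>2 + y\<^sup>2) / 2 + (a * x + b * y) - (a\<^sup>2 + b\<^sup>2) / 2) / (2 * pi))"
    for a b x y
  have G_meas[measurable]: "case_prod (G a b) \<in> borel_measurable (borel \<Otimes>\<^sub>M borel)" for a b
    unfolding G_def case_prod_beta by measurable
  have dens: "(\<integral>\<^sup>+x. \<integral>\<^sup>+y. g (a + x) (b + y) \<partial>std_normal \<partial>std_normal)
      = (\<integral>\<^sup>+x. \<integral>\<^sup>+y. G a b x y \<partial>lborel \<partial>lborel)" for a b
  proof -
    have "(\<integral>\<^sup>+x. \<integral>\<^sup>+y. g (a + x) (b + y) \<partial>std_normal \<partial>std_normal)
       = (\<integral>\<^sup>+x. (\<integral>\<^sup>+y. g (a + x) y * ennreal (exp (b * y - b\<^sup>2 / 2)) \<partial>std_normal) \<partial>std_normal)"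
      by (subst std_normal_shift) auto
    also have "\<dots> = (\<integral>\<^sup>+x. (\<integral>\<^sup>+y. g x y * ennreal (exp (b * y - b\<^sup>2 / 2)) \<partial>std_normal)
        * ennreal (exp (a * x - a\<^sup>2 / 2)) \<partial>std_normal)"
      by (rule std_normal_shift, rule N.borel_measurable_nn_integral) measurable
    also have "\<dots> = (\<integral>\<^sup>+x. \<integral>\<^sup>+y. G a b x y \<partial>lborel \<partial>lborel)"
    proof -
      have "ennreal (std_normal_density x) * ((\<integral>\<^sup>+y. g x y * ennreal (exp (b * y - b\<^sup>2 / 2)) \<partial>std_normal)
        * ennreal (exp (a * x - a\<^sup>2 / 2))) = (\<integral>\<^sup>+y. G a b x y \<partial>lborel)" for x
      proof -
        have "ennreal (std_normal_density x) * ((\<integral>\<^sup>+y. g x y * ennreal (exp (b * y - b\<^sup>2 / 2)) \<partial>std_normal)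
        * ennreal (exp (a * x - a\<^sup>2 / 2))) =
          (\<integral>\<^sup>+y. ennreal (std_normal_density y) * (g x y * ennreal (exp (b * y - b\<^sup>2 / 2))) \<partial>lborel)
            * ennreal (std_normal_density x * exp (a * x - a\<^sup>2 / 2))"
          by (subst nn_integral_density) (auto simp: ennreal_mult mult_ac)
        also have "\<dots> = (\<integral>\<^sup>+y. ennreal (std_normal_density y) * (g x y * ennreal (exp (b * y - b\<^sup>2 / 2)))
            * ennreal (std_normal_density x * exp (a * x - a\<^sup>2 / 2)) \<partial>lborel)"
          by (subst nn_integral_multc) auto
        also have "\<dots> = (\<integral>\<^sup>+y. G a b x y \<partial>lborel)"
        proof (rule nn_integral_cong)
          fix y
          have "std_normal_density y * (exp (b * y - b\<^sup>2 / 2) * (std_normal_density x * exp (a * x - a\<^sup>2 / 2)))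
            = exp (- (x\<^sup>2 + y\<^sup>2) / 2 + (a * x + b * y) - (a\<^sup>2 + b\<^sup>2) / 2) / (2 * pi)"
          proof -
            have "sqrt (2 * pi) * sqrt (2 * pi) = 2 * pi" by simp
            then have "std_normal_density y * (exp (b * y - b\<^sup>2 / 2) * (std_normal_density x * exp (a * x - a\<^sup>2 / 2)))
              = (exp (- y\<^sup>2 / 2) * exp (b * y - b\<^sup>2 / 2) * exp (- x\<^sup>2 / 2) * exp (a * x - a\<^sup>2 / 2)) / (2 * pi)"
              by (simp add: std_normal_density_def mult_ac)
            then show ?thesis
              by (simp add: exp_add[symmetric]) (simp add: field_simps)
          qed
          moreover have "ennreal (std_normal_density y) * (g x y * ennreal (exp (b * y - b\<^sup>2 / 2)))
            * ennreal (std_normal_density x * exp (a * x - a\<^sup>2 / 2)) = g x y * ennreal (std_normal_density y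
              * (exp (b * y - b\<^sup>2 / 2) * (std_normal_density x * exp (a * x - a\<^sup>2 / 2))))"
            by (simp add: ennreal_mult mult_ac)
          ultimately show "ennreal (std_normal_density y) * (g x y * ennreal (exp (b * y - b\<^sup>2 / 2)))
            * ennreal (std_normal_density x * exp (a * x - a\<^sup>2 / 2)) = G a b x y"
            by (simp only: G_def)
        qed
        finally show ?thesis .
      qed
      then show ?thesis
        by (subst nn_integral_density) auto
    qed
    finally show ?thesis .
  qed
  define r where "r = sqrt (a\<^sup>2 + b\<^sup>2)"
  have r2: "r\<^sup>2 = a\<^sup>2 + b\<^sup>2" and r0: "r \<ge> 0" by (auto simp: r_def)
  have "(\<integral>\<^sup>+x. \<integral>\<^sup>+y. G a b x y \<partial>lborel \<partial>lborel) = (\<integral>\<^sup>+x. \<integral>\<^sup>+y. G r 0 x y \<partial>lborel \<partial>lborel)"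
  proof (cases "a = - r")
    \<comment> \<open>rotation by \<open>\<pi>\<close> has no shear factorisation; here a reflection does the same\<close>
    case True
    then have b: "b = 0" using r2 by simp
    have "G r 0 x y = (\<lambda>x. G a b x y) (0 + (- 1) * x)" for x y
      unfolding G_def using True b radial[of x y "- x" y] by simp
    then have "(\<integral>\<^sup>+x. \<integral>\<^sup>+y. G r 0 x y \<partial>lborel \<partial>lborel) = (\<integral>\<^sup>+x. \<integral>\<^sup>+y. G a b (0 + (- 1) * x) y \<partial>lborel \<partial>lborel)"
      by simp
    also have "\<dots> = (\<integral>\<^sup>+x. \<integral>\<^sup>+y. G a b x y \<partial>lborel \<partial>lborel)"
      using nn_integral_real_affine[of "\<lambda>x. \<integral>\<^sup>+y. G a b x y \<partial>lborel" "-1" 0] by simp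
    finally show ?thesis by simp
  next
    case False
    then have rpos: "r > 0" using r0 r2 by (cases "r = 0") auto
    define c s where "c = a / r" and "s = b / r"
    have cs: "c\<^sup>2 + s\<^sup>2 = 1"
      using rpos unfolding c_def s_def power_divide add_divide_distrib[symmetric] r2[symmetric] by simp
    have c: "c \<noteq> - 1"
      using False rpos by (auto simp: c_def field_simps)
    have a: "a = r * c" and b: "b = r * s" using rpos by (auto simp: c_def s_def)
    have "G a b (c * x - s * y) (s * x + c * y) = G r 0 x y" for x y
    proof -
      have 1: "(c * x - s * y)\<^sup>2 + (s * x + c * y)\<^sup>2 = x\<^sup>2 + y\<^sup>2"
      proof -
        have "(c * x - s * y)\<^sup>2 + (s * x + c * y)\<^sup>2 = (c\<^sup>2 + s\<^sup>2) * (x\<^sup>2 + y\<^sup>2)"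
          by (simp add: power2_eq_square algebra_simps)
        then show ?thesis using cs by simp
      qed
      have 2: "a * (c * x - s * y) + b * (s * x + c * y) = r * x"
      proof -
        have "a * (c * x - s * y) + b * (s * x + c * y) = r * (c\<^sup>2 + s\<^sup>2) * x"
          unfolding a b by (simp add: power2_eq_square algebra_simps)
        then show ?thesis using cs by simp
      qed
      show ?thesis
        unfolding G_def 1 2 radial[OF 1] using r2 by simp
    qed
    then show ?thesis
      using nn_integral_lborel_rotate[OF G_meas cs c, of a b] by simp
  qed
  then show ?thesis
    using dens[of a b] dens[of r 0] by (simp add: r_def)
qed

section \<open>Functions of Gaussian vectors that are radial in some coordinates\<close>

abbreviation gauss :: "nat set \<Rightarrow> (nat \<Rightarrow> real) measure" where
  "gauss I \<equiv> Pi\<^sub>M I (\<lambda>_. std_normal)"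

definition shifted_mean :: "nat set \<Rightarrow> ((nat \<Rightarrow> real) \<Rightarrow> ennreal) \<Rightarrow> (nat \<Rightarrow> real) \<Rightarrow> ennreal" where
  "shifted_mean I f \<theta> = (\<integral>\<^sup>+\<epsilon>. f (\<lambda>l\<in>I. \<theta> l + \<epsilon> l) \<partial>gauss I)"

text \<open>
  The functions of the coordinates outside \<open>J\<close> and of the Euclidean norm of the coordinates in \<open>J\<close>. With
  \<open>J = {m..D}\<close> these include the indicators of all events known to the residual filtration at time \<open>m - 1\<close>.
\<close>

definition radial_in :: "nat set \<Rightarrow> nat set \<Rightarrow> ((nat \<Rightarrow> real) \<Rightarrow> 'b) \<Rightarrow> bool" where
  "radial_in I J f \<longleftrightarrow> (\<forall>y\<in>extensional I. \<forall>y'\<in>extensional I.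
     (\<forall>i\<in>I - J. y i = y' i) \<longrightarrow> (\<Sum>i\<in>J. (y i)\<^sup>2) = (\<Sum>i\<in>J. (y' i)\<^sup>2) \<longrightarrow> f y = f y')"

lemma radial_inD:
  "radial_in I J f \<Longrightarrow> y \<in> extensional I \<Longrightarrow> y' \<in> extensional I \<Longrightarrow> (\<And>i. i \<in> I - J \<Longrightarrow> y i = y' i)
    \<Longrightarrow> (\<Sum>i\<in>J. (y i)\<^sup>2) = (\<Sum>i\<in>J. (y' i)\<^sup>2) \<Longrightarrow> f y = f y'"
  unfolding radial_in_def by blast

lemma prob_space_gauss: "prob_space (gauss I)"
proof -
  interpret product_prob_space "\<lambda>_. std_normal" I
    by (intro product_prob_spaceI prob_space_std_normal)
  show ?thesis by unfold_locales
qed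

lemma sets_gauss [measurable_cong]: "sets (gauss I) = sets (Pi\<^sub>M I (\<lambda>_. borel))"
  by (intro sets_PiM_cong) auto

lemma space_gauss: "space (gauss I) = extensional I"
  by (auto simp: space_PiM PiE_def)

lemma gauss_insert:
  assumes "finite I" "i \<notin> I" "F \<in> borel_measurable (Pi\<^sub>M (insert i I) (\<lambda>_. borel))"
  shows "(\<integral>\<^sup>+x. F x \<partial>gauss (insert i I)) = (\<integral>\<^sup>+x. \<integral>\<^sup>+u. F (x(i := u)) \<partial>std_normal \<partial>gauss I)"
proof -
  interpret product_sigma_finite "\<lambda>_. std_normal"
    by (intro product_sigma_finite.intro prob_space_imp_sigma_finite prob_space_std_normal)
  have "F \<in> borel_measurable (gauss (insert i I))"
    using assms(3) measurable_cong_sets[OF sets_gauss refl] by blast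
  with assms show ?thesis by (intro product_nn_integral_insert)
qed

lemma gauss_coord_cong:
  assumes "finite I" "i \<in> I"
    and "F \<in> borel_measurable (Pi\<^sub>M I (\<lambda>_. borel))" "G \<in> borel_measurable (Pi\<^sub>M I (\<lambda>_. borel))"
    and "\<And>x. x \<in> extensional (I - {i}) \<Longrightarrow>
      (\<integral>\<^sup>+u. F (x(i := u)) \<partial>std_normal) = (\<integral>\<^sup>+u. G (x(i := u)) \<partial>std_normal)"
  shows "(\<integral>\<^sup>+x. F x \<partial>gauss I) = (\<integral>\<^sup>+x. G x \<partial>gauss I)"
proof -
  have I: "I = insert i (I - {i})" using assms(2) by auto
  have "(\<integral>\<^sup>+x. F x \<partial>gauss (insert i (I - {i}))) = (\<integral>\<^sup>+x. G x \<partial>gauss (insert i (I - {i})))"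
  proof (subst (1 2) gauss_insert)
    show "(\<integral>\<^sup>+x. \<integral>\<^sup>+u. F (x(i := u)) \<partial>std_normal \<partial>gauss (I - {i}))
        = (\<integral>\<^sup>+x. \<integral>\<^sup>+u. G (x(i := u)) \<partial>std_normal \<partial>gauss (I - {i}))"
      by (rule nn_integral_cong) (simp add: assms(5) space_gauss)
  qed (use assms I in auto)
  then show ?thesis using I by simp
qed

lemma shifted_mean_cong:
  assumes "\<And>l. l \<in> I \<Longrightarrow> \<theta> l = \<theta>' l"
  shows "shifted_mean I f \<theta> = shifted_mean I f \<theta>'"
  unfolding shifted_mean_def using assms
  by (intro nn_integral_cong arg_cong[where f=f]) (auto simp: restrict_def)

lemma shift_measurable [measurable]:
  "(\<lambda>\<epsilon>. \<lambda>l\<in>I. \<theta> l + \<epsilon> l) \<in> Pi\<^sub>M I (\<lambda>_. borel :: real measure) \<rightarrow>\<^sub>M Pi\<^sub>M I (\<lambda>_. borel :: real measure)"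
  by measurable

lemma shifted_mean_merge:
  assumes I: "finite I" "J \<subseteq> I" "i \<in> J" "j \<in> J" "i \<noteq> j"
    and f[measurable]: "f \<in> borel_measurable (Pi\<^sub>M I (\<lambda>_. borel))" and radial: "radial_in I J f"
  shows "shifted_mean I f \<theta> = shifted_mean I f (\<theta>(i := sqrt ((\<theta> i)\<^sup>2 + (\<theta> j)\<^sup>2), j := 0))"
proof -
  define I0 where "I0 = I - {i, j}"
  have I0: "I = insert j (insert i I0)" "i \<notin> I0" "j \<notin> insert i I0" "finite I0"
    using I by (auto simp: I0_def)
  define \<theta>' where "\<theta>' = \<theta>(i := sqrt ((\<theta> i)\<^sup>2 + (\<theta> j)\<^sup>2), j := 0)"
  define g where "g x u w = f ((\<lambda>l\<in>I. \<theta> l + x l)(i := u, j := w))" for x :: "nat \<Rightarrow> real" and u w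
  have split: "shifted_mean I f \<eta>
      = (\<integral>\<^sup>+x. \<integral>\<^sup>+u. \<integral>\<^sup>+w. g x (\<eta> i + u) (\<eta> j + w) \<partial>std_normal \<partial>std_normal \<partial>gauss I0)"
    if \<eta>: "\<And>l. l \<in> I0 \<Longrightarrow> \<eta> l = \<theta> l" for \<eta>
  proof -
    define F where "F \<epsilon> = f (\<lambda>l\<in>I. \<eta> l + \<epsilon> l)" for \<epsilon>
    have F[measurable]: "F \<in> borel_measurable (Pi\<^sub>M (insert j (insert i I0)) (\<lambda>_. borel))"
      unfolding F_def I0(1)[symmetric] by measurable
    interpret N: prob_space std_normal by (rule prob_space_std_normal)
    have "shifted_mean I f \<eta> = (\<integral>\<^sup>+\<epsilon>. F \<epsilon> \<partial>gauss (insert j (insert i I0)))"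
      by (simp add: shifted_mean_def F_def I0(1))
    also have "\<dots> = (\<integral>\<^sup>+z. \<integral>\<^sup>+w. F (z(j := w)) \<partial>std_normal \<partial>gauss (insert i I0))"
      using I0 by (intro gauss_insert) auto
    also have "\<dots> = (\<integral>\<^sup>+x. \<integral>\<^sup>+u. \<integral>\<^sup>+w. F (x(i := u, j := w)) \<partial>std_normal \<partial>std_normal \<partial>gauss I0)"
      using I0 by (intro gauss_insert N.borel_measurable_nn_integral) measurable
    moreover have "F (x(i := u, j := w)) = g x (\<eta> i + u) (\<eta> j + w)" for x u w
      unfolding F_def g_def using I(5) I0
      by (intro arg_cong[where f=f]) (auto simp: fun_eq_iff restrict_def \<eta>)
    ultimately show ?thesis by simp
  qed
  have gm: "case_prod (g x) \<in> borel_measurable (borel \<Otimes>\<^sub>M borel)" for x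
  proof -
    have "(\<lambda>z. (\<lambda>l\<in>I. \<theta> l + x l)(i := fst z, j := snd z)) \<in> (borel \<Otimes>\<^sub>M borel) \<rightarrow>\<^sub>M Pi\<^sub>M I (\<lambda>_. borel)"
    proof (rule measurable_PiM_single')
      show "(\<lambda>z. ((\<lambda>l\<in>I. \<theta> l + x l)(i := fst z, j := snd z)) l) \<in> borel_measurable (borel \<Otimes>\<^sub>M borel)" for l
        by (cases "l = j"; cases "l = i") auto
      show "(\<lambda>z. (\<lambda>l\<in>I. \<theta> l + x l)(i := fst z, j := snd z)) \<in> space (borel \<Otimes>\<^sub>M borel) \<rightarrow> I \<rightarrow>\<^sub>E space borel"
        using I by (auto simp: PiE_def extensional_def)
    qed
    then show ?thesis
      unfolding g_def case_prod_beta by measurable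
  qed
  have gr: "g x u w = g x u' w'" if "u\<^sup>2 + w\<^sup>2 = u'\<^sup>2 + w'\<^sup>2" for x u w u' w'
  proof -
    have "finite J" using I finite_subset by blast
    then have "(\<Sum>l\<in>J. (((\<lambda>l\<in>I. \<theta> l + x l)(i := u, j := w)) l)\<^sup>2)
        = u\<^sup>2 + w\<^sup>2 + (\<Sum>l\<in>J - {i} - {j}. ((\<lambda>l\<in>I. \<theta> l + x l) l)\<^sup>2)" for u w
      using I by (simp add: sum.remove[of J i] sum.remove[of "J - {i}" j])
    then show ?thesis
      unfolding g_def using I that
      by (intro radial_inD[OF radial]) (auto simp: extensional_def)
  qed
  have "shifted_mean I f \<theta> = (\<integral>\<^sup>+x. \<integral>\<^sup>+u. \<integral>\<^sup>+w. g x (\<theta> i + u) (\<theta> j + w) \<partial>std_normal \<partial>std_normal \<partial>gauss I0)"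
    by (rule split) simp
  also have "\<dots> = (\<integral>\<^sup>+x. \<integral>\<^sup>+u. \<integral>\<^sup>+w. g x (\<theta>' i + u) (\<theta>' j + w) \<partial>std_normal \<partial>std_normal \<partial>gauss I0)"
  proof (rule nn_integral_cong)
    fix x
    show "(\<integral>\<^sup>+u. \<integral>\<^sup>+w. g x (\<theta> i + u) (\<theta> j + w) \<partial>std_normal \<partial>std_normal)
        = (\<integral>\<^sup>+u. \<integral>\<^sup>+w. g x (\<theta>' i + u) (\<theta>' j + w) \<partial>std_normal \<partial>std_normal)"
      using std_normal_radial[OF gm gr, of x "\<theta> i" "\<theta> j"] I(5) by (simp add: \<theta>'_def)
  qed
  also have "\<dots> = shifted_mean I f \<theta>'"
    using I0 by (intro split[symmetric]) (auto simp: \<theta>'_def)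
  finally show ?thesis by (simp add: \<theta>'_def)
qed

text \<open>
  Iterated planar rotations gather the shifts of all coordinates in \<open>K\<close> at the coordinate \<open>i\<close>.
\<close>

lemma shifted_mean_collapse:
  assumes "finite K" "K \<noteq> {}" "K \<subseteq> J" "i \<notin> K"
    and I: "finite I" "J \<subseteq> I" "i \<in> J"
    and f: "f \<in> borel_measurable (Pi\<^sub>M I (\<lambda>_. borel))" and radial: "radial_in I J f"
  shows "shifted_mean I f \<theta>
    = shifted_mean I f (\<lambda>l. if l = i then sqrt ((\<theta> i)\<^sup>2 + (\<Sum>k\<in>K. (\<theta> k)\<^sup>2)) else if l \<in> K then 0 else \<theta> l)"
  using assms(1-4)
proof (induction K rule: finite_ne_induct)
  case (singleton k)
  then show ?case
    by (subst shifted_mean_merge[OF I(1-3) _ _ f radial, of k])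
       (auto intro!: shifted_mean_cong)
next
  case (insert k K)
  let ?\<eta> = "\<lambda>l. if l = i then sqrt ((\<theta> i)\<^sup>2 + (\<Sum>k\<in>K. (\<theta> k)\<^sup>2)) else if l \<in> K then 0 else \<theta> l"
  have "shifted_mean I f \<theta> = shifted_mean I f ?\<eta>"
    using insert by simp
  also have "\<dots> = shifted_mean I f (?\<eta>(i := sqrt ((?\<eta> i)\<^sup>2 + (?\<eta> k)\<^sup>2), k := 0))"
    using insert by (intro shifted_mean_merge[OF I(1-3) _ _ f radial]) auto
  also have "\<dots> = shifted_mean I f (\<lambda>l. if l = i then sqrt ((\<theta> i)\<^sup>2 + (\<Sum>k\<in>insert k K. (\<theta> k)\<^sup>2))
      else if l \<in> insert k K then 0 else \<theta> l)"
    using insert by (intro shifted_mean_cong) (auto simp: sum_nonneg add_nonneg_nonneg add_ac)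
  finally show ?case .
qed

text \<open>
  Both shifts collapse to the same canonical form, which carries the whole norm at one coordinate of \<open>J\<close>.
  Having two coordinates in \<open>J\<close> guarantees a collapse step, and that step also fixes the sign of the
  gathered shift.
\<close>

lemma shifted_mean_radial:
  assumes I: "finite I" "J \<subseteq> I" "card J \<ge> 2"
    and f: "f \<in> borel_measurable (Pi\<^sub>M I (\<lambda>_. borel))" and radial: "radial_in I J f"
    and off: "\<And>l. l \<in> I - J \<Longrightarrow> \<theta> l = \<theta>' l"
    and norm: "(\<Sum>l\<in>J. (\<theta> l)\<^sup>2) = (\<Sum>l\<in>J. (\<theta>' l)\<^sup>2)"
  shows "shifted_mean I f \<theta> = shifted_mean I f \<theta>'"
proof -
  have J: "finite J" using I finite_subset by blast
  obtain i where i: "i \<in> J" using I(3) by fastforce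
  have ne: "J - {i} \<noteq> {}"
  proof
    assume "J - {i} = {}"
    then have "card J \<le> card {i}" by (intro card_mono) auto
    with I(3) show False by simp
  qed
  have sum: "(\<eta> i)\<^sup>2 + (\<Sum>k\<in>J - {i}. (\<eta> k)\<^sup>2) = (\<Sum>l\<in>J. (\<eta> l)\<^sup>2)" for \<eta> :: "nat \<Rightarrow> real"
    using J i by (simp add: sum.remove)
  have canonical: "shifted_mean I f \<eta>
      = shifted_mean I f (\<lambda>l. if l = i then sqrt (\<Sum>l\<in>J. (\<eta> l)\<^sup>2) else if l \<in> J then 0 else \<eta> l)" for \<eta>
  proof -
    have "shifted_mean I f \<eta> = shifted_mean I f (\<lambda>l. if l = i then sqrt ((\<eta> i)\<^sup>2 + (\<Sum>k\<in>J - {i}. (\<eta> k)\<^sup>2))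
        else if l \<in> J - {i} then 0 else \<eta> l)"
      using J ne by (intro shifted_mean_collapse[OF _ _ _ _ I(1,2) i f radial]) auto
    also have "\<dots> = shifted_mean I f (\<lambda>l. if l = i then sqrt (\<Sum>l\<in>J. (\<eta> l)\<^sup>2) else if l \<in> J then 0 else \<eta> l)"
      by (rule shifted_mean_cong) (simp add: sum)
    finally show ?thesis .
  qed
  note canonical[of \<theta>]
  also have "shifted_mean I f (\<lambda>l. if l = i then sqrt (\<Sum>l\<in>J. (\<theta> l)\<^sup>2) else if l \<in> J then 0 else \<theta> l)
      = shifted_mean I f (\<lambda>l. if l = i then sqrt (\<Sum>l\<in>J. (\<theta>' l)\<^sup>2) else if l \<in> J then 0 else \<theta>' l)"
    by (intro shifted_mean_cong) (auto simp: norm off)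
  also have "\<dots> = shifted_mean I f \<theta>'"
    by (rule canonical[symmetric])
  finally show ?thesis .
qed

lemma shifted_mean_even:
  assumes "finite K" "K \<subseteq> I" "finite I"
    and f[measurable]: "f \<in> borel_measurable (Pi\<^sub>M I (\<lambda>_. borel))"
    and even: "\<And>l y. l \<in> K \<Longrightarrow> y \<in> extensional I \<Longrightarrow> f (y(l := - y l)) = f y"
    and "\<And>l. l \<in> K \<Longrightarrow> \<theta> l = 0"
  shows "shifted_mean I f (\<lambda>l. if l \<in> K then k else \<theta> l)
    = (\<integral>\<^sup>+\<epsilon>. f (\<lambda>l\<in>I. \<theta> l + \<epsilon> l) * (\<Prod>l\<in>K. ennreal (tilt k (\<epsilon> l))) \<partial>gauss I)"
  using assms(1,2,5,6)
proof (induction K arbitrary: \<theta> rule: finite_induct)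
  case empty
  then show ?case by (simp add: shifted_mean_def restrict_def)
next
  case (insert j K)
  have tilts[measurable]: "(\<lambda>\<epsilon>. \<Prod>l\<in>K'. ennreal (tilt k (\<epsilon> l))) \<in> borel_measurable (Pi\<^sub>M I (\<lambda>_. borel))" if "K' \<subseteq> I" for K'
    using that by (intro borel_measurable_prod_ennreal) (auto intro!: measurable_compose[OF measurable_component_singleton])
  have [measurable]: "K \<subseteq> I" "insert j K \<subseteq> I" using insert.prems by auto
  let ?\<theta> = "\<theta>(j := k)"
  have "shifted_mean I f (\<lambda>l. if l \<in> insert j K then k else \<theta> l)
      = shifted_mean I f (\<lambda>l. if l \<in> K then k else ?\<theta> l)"
    by (intro shifted_mean_cong) auto
  also have "\<dots> = (\<integral>\<^sup>+\<epsilon>. f (\<lambda>l\<in>I. ?\<theta> l + \<epsilon> l) * (\<Prod>l\<in>K. ennreal (tilt k (\<epsilon> l))) \<partial>gauss I)"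
    using insert by (intro insert.IH) auto
  also have "\<dots> = (\<integral>\<^sup>+\<epsilon>. f (\<lambda>l\<in>I. \<theta> l + \<epsilon> l) * (\<Prod>l\<in>insert j K. ennreal (tilt k (\<epsilon> l))) \<partial>gauss I)"
  proof (rule gauss_coord_cong)
    show "finite I" "j \<in> I" using assms insert.prems by auto
    show "(\<lambda>\<epsilon>. f (\<lambda>l\<in>I. ?\<theta> l + \<epsilon> l) * (\<Prod>l\<in>K. ennreal (tilt k (\<epsilon> l)))) \<in> borel_measurable (Pi\<^sub>M I (\<lambda>_. borel))"
      "(\<lambda>\<epsilon>. f (\<lambda>l\<in>I. \<theta> l + \<epsilon> l) * (\<Prod>l\<in>insert j K. ennreal (tilt k (\<epsilon> l)))) \<in> borel_measurable (Pi\<^sub>M I (\<lambda>_. borel))"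
      by measurable
    fix x :: "nat \<Rightarrow> real" assume x: "x \<in> extensional (I - {j})"
    let ?b = "\<lambda>l\<in>I. \<theta> l + x l" and ?c = "\<Prod>l\<in>K. ennreal (tilt k (x l))"
    define g where "g v = f (?b(j := v)) * ?c" for v
    have [measurable]: "(\<lambda>v. ?b(j := v)) \<in> borel \<rightarrow>\<^sub>M Pi\<^sub>M I (\<lambda>_. borel)"
    proof (rule measurable_PiM_single')
      show "(\<lambda>v. (?b(j := v)) l) \<in> borel_measurable borel" for l
        by (cases "l = j") auto
    qed (use \<open>j \<in> I\<close> in \<open>auto simp: PiE_def extensional_def\<close>)
    have g[measurable]: "g \<in> borel_measurable borel"
      unfolding g_def by measurable
    have ge: "g (- v) = g v" for v
    proof -
      have "?b(j := v) \<in> extensional I" using \<open>j \<in> I\<close> by (auto simp: extensional_def)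
      from insert.prems(2)[OF insertI1 this] show ?thesis
        by (simp only: g_def fun_upd_upd fun_upd_same)
    qed
    have prodK: "(\<Prod>l\<in>K. ennreal (tilt k ((x(j := u)) l))) = ?c" for u
      using insert.hyps by (intro prod.cong) auto
    have 1: "(\<lambda>l\<in>I. ?\<theta> l + (x(j := u)) l) = ?b(j := k + u)" for u
      using \<open>j \<in> I\<close> by (auto simp: fun_eq_iff)
    have 2: "(\<lambda>l\<in>I. \<theta> l + (x(j := u)) l) = ?b(j := u)" for u
      using \<open>j \<in> I\<close> insert.prems(3)[of j] by (auto simp: fun_eq_iff)
    have "(\<integral>\<^sup>+u. f (\<lambda>l\<in>I. ?\<theta> l + (x(j := u)) l) * (\<Prod>l\<in>K. ennreal (tilt k ((x(j := u)) l))) \<partial>std_normal)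
        = (\<integral>\<^sup>+u. g (k + u) \<partial>std_normal)"
      unfolding prodK 1 g_def ..
    also have "\<dots> = (\<integral>\<^sup>+u. g u * ennreal (tilt k u) \<partial>std_normal)"
      by (rule std_normal_shift_even[OF g ge])
    also have "\<dots> = (\<integral>\<^sup>+u. f (\<lambda>l\<in>I. \<theta> l + (x(j := u)) l) * (\<Prod>l\<in>insert j K. ennreal (tilt k ((x(j := u)) l))) \<partial>std_normal)"
      unfolding 2 g_def prod.insert[OF insert.hyps] prodK by (simp add: mult_ac)
    finally show "(\<integral>\<^sup>+u. f (\<lambda>l\<in>I. ?\<theta> l + (x(j := u)) l) * (\<Prod>l\<in>K. ennreal (tilt k ((x(j := u)) l))) \<partial>std_normal)
      = (\<integral>\<^sup>+u. f (\<lambda>l\<in>I. \<theta> l + (x(j := u)) l) * (\<Prod>l\<in>insert j K. ennreal (tilt k ((x(j := u)) l))) \<partial>std_normal)" .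
  qed
  finally show ?case .
qed

lemma cosh_le_exp_square:
  fixes z :: real
  assumes "0 \<le> z" "z \<le> 1"
  shows "cosh z \<le> exp (z\<^sup>2)"
proof -
  have 1: "exp z \<le> 1 + z + z\<^sup>2" using assms by (rule exp_bound)
  have "exp (- z) \<le> 1 / (1 + z)"
    using exp_ge_add_one_self[of z] assms by (simp add: exp_minus field_simps)
  also have "\<dots> \<le> 1 - z + z\<^sup>2"
    using assms by (simp add: field_simps power2_eq_square)
  finally have "cosh z \<le> 1 + z\<^sup>2" using 1 by (simp add: cosh_field_def)
  also have "\<dots> \<le> exp (z\<^sup>2)" by (rule exp_ge_add_one_self)
  finally show ?thesis .
qed

lemma nn_integral_gauss_prod:
  assumes "finite I" "K \<subseteq> I" and h: "h \<in> borel_measurable borel"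
  shows "(\<integral>\<^sup>+\<epsilon>. (\<Prod>l\<in>K. h (\<epsilon> l)) \<partial>gauss I) = (\<integral>\<^sup>+x. h x \<partial>std_normal) ^ card K"
proof -
  interpret product_sigma_finite "\<lambda>_. std_normal"
    by (intro product_sigma_finite.intro prob_space_imp_sigma_finite prob_space_std_normal)
  have "(\<Prod>l\<in>K. h (\<epsilon> l)) = (\<Prod>l\<in>I. (if l \<in> K then h else (\<lambda>_. 1)) (\<epsilon> l))" for \<epsilon> :: "nat \<Rightarrow> real"
    using assms by (intro prod.mono_neutral_cong_left) auto
  then have "(\<integral>\<^sup>+\<epsilon>. (\<Prod>l\<in>K. h (\<epsilon> l)) \<partial>gauss I)
      = (\<Prod>l\<in>I. \<integral>\<^sup>+x. (if l \<in> K then h else (\<lambda>_. 1)) x \<partial>std_normal)"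
    using assms h by (simp only:, intro product_nn_integral_prod) auto
  also have "\<dots> = (\<Prod>l\<in>K. \<integral>\<^sup>+x. h x \<partial>std_normal)"
    using assms prob_space.emeasure_space_1[OF prob_space_std_normal]
    by (intro prod.mono_neutral_cong_right) auto
  finally show ?thesis by simp
qed

lemma nn_integral_gauss_component:
  assumes "finite I" "l \<in> I" "h \<in> borel_measurable borel"
  shows "(\<integral>\<^sup>+\<epsilon>. h (\<epsilon> l) \<partial>gauss I) = (\<integral>\<^sup>+x. h x \<partial>std_normal)"
  using nn_integral_gauss_prod[of I "{l}" h] assms by simp

section \<open>Increasing the energy of the mean\<close>

text \<open>
  By rotation, the shift \<open>\<theta>\<close> may be taken to have all its energy in \<open>J\<close> at one coordinate, and the extra
  energy \<open>h\<^sup>2\<close> of \<open>\<theta>'\<close> to be spread evenly over the \<open>n\<close> others. After symmetrisation the ratio of the two laws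
  is \<open>L = \<Prod>l\<in>K. tilt k (\<epsilon> l)\<close> with \<open>k\<^sup>2 = h\<^sup>2 / n\<close>, whose second moment \<open>cosh (k\<^sup>2) ^ n\<close> is at most
  \<open>exp (h\<^sup>4 / n)\<close>. On \<open>B\<close> the inequality \<open>L \<le> 2 + L\<^sup>2 / 8\<close> serves as a linear form of Cauchy--Schwarz.
\<close>

proposition shifted_mean_energy_perturbation:
  assumes I: "finite I" "J \<subseteq> I" and n: "card J = Suc n" "n \<ge> 1"
    and B[measurable]: "B \<in> sets (Pi\<^sub>M I (\<lambda>_. borel))" and radial: "radial_in I J (\<lambda>y. y \<in> B)"
    and off: "\<And>l. l \<in> I - J \<Longrightarrow> \<theta>' l = \<theta> l"
    and energy: "(\<Sum>l\<in>J. (\<theta>' l)\<^sup>2) = (\<Sum>l\<in>J. (\<theta> l)\<^sup>2) + h\<^sup>2" and h: "h ^ 4 \<le> real n"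
  shows "shifted_mean I (indicator B) \<theta>' \<le> 2 * shifted_mean I (indicator B) \<theta> + ennreal (exp (h ^ 4 / n) / 8)"
proof -
  let ?f = "indicator B :: (nat \<Rightarrow> real) \<Rightarrow> ennreal"
  have radf: "radial_in I J ?f"
    unfolding radial_in_def
  proof (intro ballI impI)
    fix y y' :: "nat \<Rightarrow> real"
    assume y: "y \<in> extensional I" "y' \<in> extensional I" and eq: "\<forall>i\<in>I - J. y i = y' i"
      "(\<Sum>i\<in>J. (y i)\<^sup>2) = (\<Sum>i\<in>J. (y' i)\<^sup>2)"
    have "(y \<in> B) = (y' \<in> B)"
      using eq(1) by (intro radial_inD[OF radial y _ eq(2)]) blast
    then show "?f y = ?f y'" by (simp add: indicator_def)
  qed
  have J: "finite J" using I finite_subset by blast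
  obtain i where i: "i \<in> J" using n by fastforce
  define K where "K = J - {i}"
  have K: "finite K" "K \<subseteq> I" "i \<notin> K" "card K = n" "J = insert i K"
    using J I i n by (auto simp: K_def)
  define a where "a = sqrt (\<Sum>l\<in>J. (\<theta> l)\<^sup>2)"
  define k where "k = h / sqrt (real n)"
  have a2: "a\<^sup>2 = (\<Sum>l\<in>J. (\<theta> l)\<^sup>2)" by (simp add: a_def sum_nonneg)
  have k2: "k\<^sup>2 = h\<^sup>2 / n" by (simp add: k_def power_divide)
  define \<theta>0 where "\<theta>0 l = (if l = i then a else if l \<in> K then 0 else \<theta> l)" for l
  define \<theta>1 where "\<theta>1 l = (if l \<in> K then k else \<theta>0 l)" for l
  define L where "L \<epsilon> = (\<Prod>l\<in>K. tilt k (\<epsilon> l))" for \<epsilon> :: "nat \<Rightarrow> real"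
  have L0: "L \<epsilon> \<ge> 0" for \<epsilon> by (simp add: L_def prod_nonneg tilt_nonneg)
  have Lm[measurable]: "L \<in> borel_measurable (Pi\<^sub>M I (\<lambda>_. borel))"
    unfolding L_def using K(2)
    by (intro borel_measurable_prod) (auto intro!: measurable_compose[OF measurable_component_singleton])
  have s0: "(\<Sum>l\<in>J. (\<theta>0 l)\<^sup>2) = a\<^sup>2"
  proof -
    have "(\<Sum>l\<in>K. (\<theta>0 l)\<^sup>2) = 0" using K(3) by (intro sum.neutral) (auto simp: \<theta>0_def)
    then show ?thesis using K by (simp add: \<theta>0_def)
  qed
  have s1: "(\<Sum>l\<in>J. (\<theta>1 l)\<^sup>2) = a\<^sup>2 + h\<^sup>2"
  proof -
    have "(\<Sum>l\<in>K. (\<theta>1 l)\<^sup>2) = real n * k\<^sup>2" using K by (simp add: \<theta>1_def)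
    then show ?thesis using K n by (simp add: \<theta>1_def \<theta>0_def k2)
  qed
  have "shifted_mean I ?f \<theta>' = shifted_mean I ?f \<theta>1"
  proof (rule shifted_mean_radial[OF I _ _ radf])
    show "\<theta>' l = \<theta>1 l" if "l \<in> I - J" for l
      using that off K(5) by (auto simp: \<theta>1_def \<theta>0_def)
    show "(\<Sum>l\<in>J. (\<theta>' l)\<^sup>2) = (\<Sum>l\<in>J. (\<theta>1 l)\<^sup>2)"
      by (simp only: s1 energy a2)
  qed (use n in auto)
  also have "\<dots> = (\<integral>\<^sup>+\<epsilon>. ?f (\<lambda>l\<in>I. \<theta>0 l + \<epsilon> l) * (\<Prod>l\<in>K. ennreal (tilt k (\<epsilon> l))) \<partial>gauss I)"
    unfolding \<theta>1_def
  proof (rule shifted_mean_even)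
    fix l and y :: "nat \<Rightarrow> real" assume l: "l \<in> K" and y: "y \<in> extensional I"
    have "l \<in> J" "l \<in> I" using l K by auto
    then show "?f (y(l := - y l)) = ?f y"
      using y J by (intro radial_inD[OF radf]) (auto simp: extensional_def sum.remove[of J l])
  qed (use K I in \<open>auto simp: \<theta>0_def\<close>)
  also have "\<dots> \<le> (\<integral>\<^sup>+\<epsilon>. 2 * ?f (\<lambda>l\<in>I. \<theta>0 l + \<epsilon> l) + ennreal (1/8) * (\<Prod>l\<in>K. ennreal ((tilt k (\<epsilon> l))\<^sup>2)) \<partial>gauss I)"
  proof (rule nn_integral_mono)
    fix \<epsilon> :: "nat \<Rightarrow> real"
    have 1: "(\<Prod>l\<in>K. ennreal (tilt k (\<epsilon> l))) = ennreal (L \<epsilon>)"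
      unfolding L_def by (rule prod_ennreal) (simp add: tilt_nonneg)
    have 2: "(\<Prod>l\<in>K. ennreal ((tilt k (\<epsilon> l))\<^sup>2)) = ennreal ((L \<epsilon>)\<^sup>2)"
      unfolding L_def prod_power_distrib by (rule prod_ennreal) simp
    have "0 \<le> (L \<epsilon> - 4)\<^sup>2" by simp
    then have "L \<epsilon> \<le> 2 + 1/8 * (L \<epsilon>)\<^sup>2" by (simp add: power2_diff)
    then have "ennreal (L \<epsilon>) \<le> ennreal (2 + 1/8 * (L \<epsilon>)\<^sup>2)" by (rule ennreal_leI)
    also have "\<dots> = ennreal 2 + ennreal (1/8) * ennreal ((L \<epsilon>)\<^sup>2)"
      by (simp only: ennreal_plus ennreal_mult zero_le_numeral zero_le_power2 zero_le_divide_1_iff mult_nonneg_nonneg)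
    finally have "ennreal (L \<epsilon>) \<le> 2 + ennreal (1/8) * ennreal ((L \<epsilon>)\<^sup>2)" by simp
    then show "?f (\<lambda>l\<in>I. \<theta>0 l + \<epsilon> l) * (\<Prod>l\<in>K. ennreal (tilt k (\<epsilon> l)))
       \<le> 2 * ?f (\<lambda>l\<in>I. \<theta>0 l + \<epsilon> l) + ennreal (1/8) * (\<Prod>l\<in>K. ennreal ((tilt k (\<epsilon> l))\<^sup>2))"
      unfolding 1 2 by (auto simp: indicator_def)
  qed
  also have "\<dots> = 2 * shifted_mean I ?f \<theta>0 + ennreal (1/8) * (\<integral>\<^sup>+\<epsilon>. (\<Prod>l\<in>K. ennreal ((tilt k (\<epsilon> l))\<^sup>2)) \<partial>gauss I)"
  proof -
    have [measurable]: "(\<lambda>\<epsilon>. \<Prod>l\<in>K. ennreal ((tilt k (\<epsilon> l))\<^sup>2)) \<in> borel_measurable (Pi\<^sub>M I (\<lambda>_. borel))"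
      using K(2) by (intro borel_measurable_prod_ennreal) (auto intro!: measurable_compose[OF measurable_component_singleton])
    show ?thesis
      unfolding shifted_mean_def by (subst nn_integral_add) (auto simp: nn_integral_cmult)
  qed
  also have "shifted_mean I ?f \<theta>0 = shifted_mean I ?f \<theta>"
  proof (rule shifted_mean_radial[OF I _ _ radf])
    show "\<theta>0 l = \<theta> l" if "l \<in> I - J" for l
      using that K(5) by (auto simp: \<theta>0_def)
    show "(\<Sum>l\<in>J. (\<theta>0 l)\<^sup>2) = (\<Sum>l\<in>J. (\<theta> l)\<^sup>2)"
      by (simp only: s0 a2)
  qed (use n in auto)
  also have "ennreal (1/8) * (\<integral>\<^sup>+\<epsilon>. (\<Prod>l\<in>K. ennreal ((tilt k (\<epsilon> l))\<^sup>2)) \<partial>gauss I) \<le> ennreal (exp (h ^ 4 / n) / 8)"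
  proof -
    have "(h\<^sup>2)\<^sup>2 \<le> real n"
      using h by (simp add: power_mult[symmetric])
    also have "\<dots> \<le> (real n)\<^sup>2"
      using n by (intro self_le_power) auto
    finally have "(h\<^sup>2)\<^sup>2 \<le> (real n)\<^sup>2" .
    then have "h\<^sup>2 \<le> real n" by (rule power2_le_imp_le) simp
    then have k1: "k\<^sup>2 \<le> 1" using n by (simp add: k2 field_simps)
    have "(cosh (k\<^sup>2)) ^ n \<le> exp ((k\<^sup>2)\<^sup>2) ^ n"
      using k1 by (intro power_mono cosh_le_exp_square) (auto simp: cosh_real_nonneg)
    also have "\<dots> = exp (real n * (k\<^sup>2)\<^sup>2)"
      by (rule exp_of_nat_mult[symmetric])
    also have "real n * (k\<^sup>2)\<^sup>2 = h ^ 4 / n"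
    proof -
      have "(k\<^sup>2)\<^sup>2 = h ^ 4 / (real n)\<^sup>2"
        unfolding k2 by (simp add: power_divide power_mult[symmetric])
      then show ?thesis using n by (simp add: power2_eq_square)
    qed
    finally have "(cosh (k\<^sup>2)) ^ n \<le> exp (h ^ 4 / n)" .
    moreover have "(\<integral>\<^sup>+\<epsilon>. (\<Prod>l\<in>K. ennreal ((tilt k (\<epsilon> l))\<^sup>2)) \<partial>gauss I) = ennreal (cosh (k\<^sup>2) ^ n)"
      using nn_integral_gauss_prod[OF I(1) K(2), of "\<lambda>x. ennreal ((tilt k x)\<^sup>2)"] K(4)
      by (simp add: nn_integral_tilt_square ennreal_power cosh_real_nonneg)
    ultimately show ?thesis
      by (simp add: ennreal_mult[symmetric] cosh_real_nonneg ennreal_leI)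
  qed
  finally show ?thesis by (simp add: add_left_mono)
qed

section \<open>Noise energy on an event\<close>

lemma std_normal_small_ball: "(\<integral>\<^sup>+x. indicator {-1/16..1/16} x \<partial>std_normal) \<le> ennreal (1/16)"
proof -
  have "sqrt (2 * pi) \<ge> 2"
    using pi_gt3 by (intro real_le_rsqrt) simp
  then have "1 / sqrt (2 * pi) \<le> 1/2" by (simp add: field_simps)
  then have "std_normal_density x \<le> 1/2" for x
    using mult_mono[of "1 / sqrt (2 * pi)" "1/2" "exp (- x\<^sup>2 / 2)" 1]
    by (simp add: std_normal_density_def)
  then have le: "ennreal (std_normal_density x) \<le> ennreal (1/2)" for x
    by (rule ennreal_leI)
  have "(\<integral>\<^sup>+x. indicator {-1/16..1/16} x \<partial>std_normal) \<le> (\<integral>\<^sup>+x. ennreal (1/2) * indicator {-1/16..1/16::real} x \<partial>lborel)"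
    by (subst nn_integral_density) (auto intro!: nn_integral_mono mult_right_mono le simp del: ennreal_half)
  also have "\<dots> = ennreal (1/16)"
    by (subst nn_integral_cmult_indicator) (auto simp: ennreal_mult[symmetric] simp del: ennreal_half)
  finally show ?thesis .
qed

text \<open>
  One coordinate at a time suffices: each \<open>\<epsilon> l\<close> is at most \<open>1/16\<close> in
  modulus with probability at most \<open>1/16\<close>, so at least half of an event of probability \<open>1/8\<close> has
  \<open>(\<epsilon> l)\<^sup>2 \<ge> 1/256\<close>. Summation gives the factor \<open>1/256 * 1/16 = 1/4096\<close>.
\<close>

lemma noise_energy_on_event:
  assumes I: "finite I" "K \<subseteq> I" and E[measurable]: "E \<in> sets (Pi\<^sub>M I (\<lambda>_. borel))"
    and w: "\<And>l. l \<in> K \<Longrightarrow> w l \<ge> 0" and prob: "emeasure (gauss I) E \<ge> ennreal (1/8)"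
  shows "ennreal ((\<Sum>l\<in>K. w l) / 4096) \<le> (\<integral>\<^sup>+\<epsilon>. indicator E \<epsilon> * ennreal (\<Sum>l\<in>K. w l * (\<epsilon> l)\<^sup>2) \<partial>gauss I)"
proof -
  interpret prob_space "gauss I" by (rule prob_space_gauss)
  have one: "ennreal (1/4096) \<le> (\<integral>\<^sup>+\<epsilon>. indicator E \<epsilon> * ennreal ((\<epsilon> l)\<^sup>2) \<partial>gauss I)" if l: "l \<in> I" for l
  proof -
    have [measurable]: "(\<lambda>\<epsilon>. \<epsilon> l) \<in> borel_measurable (Pi\<^sub>M I (\<lambda>_. borel))"
      using l by (rule measurable_component_singleton)
    let ?s = "\<lambda>\<epsilon>. indicator {-1/16..1/16::real} (\<epsilon> l) :: ennreal"
    have "ennreal (1/16) + ennreal (1/16) \<le> emeasure (gauss I) E"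
      using prob by (subst ennreal_plus[symmetric]) auto
    also have "\<dots> = (\<integral>\<^sup>+\<epsilon>. indicator E \<epsilon> \<partial>gauss I)"
      by simp
    also have "\<dots> \<le> (\<integral>\<^sup>+\<epsilon>. 256 * (indicator E \<epsilon> * ennreal ((\<epsilon> l)\<^sup>2)) + ?s \<epsilon> \<partial>gauss I)"
    proof (rule nn_integral_mono)
      fix \<epsilon> :: "nat \<Rightarrow> real"
      have "1 \<le> 256 * ennreal ((\<epsilon> l)\<^sup>2)" if "\<not> (- 1/16 \<le> \<epsilon> l \<and> \<epsilon> l \<le> 1/16)"
      proof -
        have "1/16 \<le> \<bar>\<epsilon> l\<bar>" using that by auto
        then have "(1/16)\<^sup>2 \<le> \<bar>\<epsilon> l\<bar>\<^sup>2" by (intro power_mono) auto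
        then have "1 \<le> 256 * (\<epsilon> l)\<^sup>2" by (simp add: power2_eq_square)
        then have "ennreal 1 \<le> ennreal (256 * (\<epsilon> l)\<^sup>2)" by (rule ennreal_leI)
        then show ?thesis by (simp add: ennreal_mult)
      qed
      then show "indicator E \<epsilon> \<le> 256 * (indicator E \<epsilon> * ennreal ((\<epsilon> l)\<^sup>2)) + ?s \<epsilon>"
        by (auto simp: indicator_def)
    qed
    also have "\<dots> = 256 * (\<integral>\<^sup>+\<epsilon>. indicator E \<epsilon> * ennreal ((\<epsilon> l)\<^sup>2) \<partial>gauss I) + (\<integral>\<^sup>+\<epsilon>. ?s \<epsilon> \<partial>gauss I)"
      by (simp add: nn_integral_add nn_integral_cmult)
    also have "\<dots> \<le> 256 * (\<integral>\<^sup>+\<epsilon>. indicator E \<epsilon> * ennreal ((\<epsilon> l)\<^sup>2) \<partial>gauss I) + ennreal (1/16)"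
      using std_normal_small_ball
      by (subst nn_integral_gauss_component[OF I(1) l]) (auto intro: add_left_mono)
    finally have "ennreal (1/16) \<le> 256 * (\<integral>\<^sup>+\<epsilon>. indicator E \<epsilon> * ennreal ((\<epsilon> l)\<^sup>2) \<partial>gauss I)"
      using ennreal_add_left_cancel_le[of "ennreal (1/16)"] by (simp only: add.commute) auto
    then have "ennreal (1/256) * ennreal (1/16) \<le> ennreal (1/256) * (256 * (\<integral>\<^sup>+\<epsilon>. indicator E \<epsilon> * ennreal ((\<epsilon> l)\<^sup>2) \<partial>gauss I))"
      by (rule mult_left_mono) simp
    moreover have "ennreal (1/256) * ennreal (1/16) = ennreal (1/4096)"
      by (subst ennreal_mult[symmetric]) auto
    moreover have "ennreal (1/256) * (256 * z) = z" for z
    proof -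
      have "ennreal (1/256) * ennreal 256 = 1" by (subst ennreal_mult[symmetric]) auto
      then show ?thesis by (simp add: mult.assoc[symmetric])
    qed
    ultimately show ?thesis by simp
  qed
  have "ennreal ((\<Sum>l\<in>K. w l) / 4096) = (\<Sum>l\<in>K. ennreal (w l) * ennreal (1/4096))"
    using w by (simp add: ennreal_mult[symmetric] sum_divide_distrib)
  also have "\<dots> \<le> (\<Sum>l\<in>K. ennreal (w l) * (\<integral>\<^sup>+\<epsilon>. indicator E \<epsilon> * ennreal ((\<epsilon> l)\<^sup>2) \<partial>gauss I))"
    using I one by (intro sum_mono mult_left_mono) auto
  also have "\<dots> = (\<Sum>l\<in>K. (\<integral>\<^sup>+\<epsilon>. ennreal (w l) * (indicator E \<epsilon> * ennreal ((\<epsilon> l)\<^sup>2)) \<partial>gauss I))"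
    using I by (intro sum.cong refl nn_integral_cmult[symmetric]) auto
  also have "\<dots> = (\<integral>\<^sup>+\<epsilon>. (\<Sum>l\<in>K. ennreal (w l) * (indicator E \<epsilon> * ennreal ((\<epsilon> l)\<^sup>2))) \<partial>gauss I)"
    using I by (intro nn_integral_sum[symmetric]) auto
  also have "\<dots> = (\<integral>\<^sup>+\<epsilon>. indicator E \<epsilon> * ennreal (\<Sum>l\<in>K. w l * (\<epsilon> l)\<^sup>2) \<partial>gauss I)"
  proof (rule nn_integral_cong)
    fix \<epsilon> :: "nat \<Rightarrow> real"
    have "ennreal (\<Sum>l\<in>K. w l * (\<epsilon> l)\<^sup>2) = (\<Sum>l\<in>K. ennreal (w l) * ennreal ((\<epsilon> l)\<^sup>2))"
      using w by (subst sum_ennreal[symmetric]) (auto intro!: sum.cong simp: ennreal_mult)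
    then show "(\<Sum>l\<in>K. ennreal (w l) * (indicator E \<epsilon> * ennreal ((\<epsilon> l)\<^sup>2))) = indicator E \<epsilon> * ennreal (\<Sum>l\<in>K. w l * (\<epsilon> l)\<^sup>2)"
      by (simp add: sum_distrib_left mult_ac)
  qed
  finally show ?thesis .
qed

section \<open>The observation and the residual filtration\<close>

lemma observation_measurable:
  "(\<lambda>\<epsilon>. \<lambda>i\<in>{1..D}. lam i * \<mu> i + \<delta> * \<epsilon> i) \<in> gauss {1..D} \<rightarrow>\<^sub>M data_space D"
  unfolding data_space_def by measurable

lemma nn_integral_obs_law:
  assumes "f \<in> borel_measurable (data_space D)"
  shows "(\<integral>\<^sup>+y. f y \<partial>obs_law D \<delta> lam \<mu>) = (\<integral>\<^sup>+\<epsilon>. f (\<lambda>i\<in>{1..D}. lam i * \<mu> i + \<delta> * \<epsilon> i) \<partial>gauss {1..D})"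
  unfolding obs_law_def noise_def using assms
  by (intro nn_integral_distr[OF observation_measurable]) simp

lemma emeasure_obs_law:
  assumes \<delta>: "\<delta> \<noteq> 0" and B: "B \<in> sets (data_space D)"
  shows "emeasure (obs_law D \<delta> lam \<mu>) B
    = shifted_mean {1..D} (indicator {y \<in> extensional {1..D}. (\<lambda>i\<in>{1..D}. \<delta> * y i) \<in> B}) (\<lambda>i. lam i * \<mu> i / \<delta>)"
proof -
  have "emeasure (obs_law D \<delta> lam \<mu>) B = (\<integral>\<^sup>+y. indicator B y \<partial>obs_law D \<delta> lam \<mu>)"
    using B by (simp add: obs_law_def)
  also have "\<dots> = (\<integral>\<^sup>+\<epsilon>. indicator B (\<lambda>i\<in>{1..D}. lam i * \<mu> i + \<delta> * \<epsilon> i) \<partial>gauss {1..D})"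
    using B by (intro nn_integral_obs_law) simp
  also have "\<dots> = shifted_mean {1..D} (indicator {y \<in> extensional {1..D}. (\<lambda>i\<in>{1..D}. \<delta> * y i) \<in> B}) (\<lambda>i. lam i * \<mu> i / \<delta>)"
    unfolding shifted_mean_def
  proof (rule nn_integral_cong)
    fix \<epsilon> :: "nat \<Rightarrow> real"
    have "(\<lambda>i\<in>{1..D}. \<delta> * (\<lambda>l\<in>{1..D}. lam l * \<mu> l / \<delta> + \<epsilon> l) i) = (\<lambda>i\<in>{1..D}. lam i * \<mu> i + \<delta> * \<epsilon> i)"
      using \<delta> by (auto simp: fun_eq_iff field_simps)
    then show "indicator B (\<lambda>i\<in>{1..D}. lam i * \<mu> i + \<delta> * \<epsilon> i) = (indicator {y \<in> extensional {1..D}. (\<lambda>i\<in>{1..D}. \<delta> * y i) \<in> B}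
       (\<lambda>l\<in>{1..D}. lam l * \<mu> l / \<delta> + \<epsilon> l) :: ennreal)"
      by (simp add: indicator_def)
  qed
  finally show ?thesis .
qed

text \<open>
  The generators are determined by \<open>y 1, ..., y m\<close> and \<open>\<parallel>y\<parallel>\<^sup>2\<close>, hence so are all sets that they generate. Given
  the first \<open>m\<close> coordinates, \<open>\<parallel>y\<parallel>\<^sup>2\<close> carries the same information as the norm of the remaining ones.
\<close>

lemma residual_filtration_sets:
  assumes "B \<in> sets (residual_filtration D m)"
  shows "B \<in> sets (data_space D)" and "m < D \<Longrightarrow> radial_in {1..D} {Suc m..D} (\<lambda>y. y \<in> B)"
proof -
  let ?\<Omega> = "space (data_space D)"
  define G where "G = (\<Union>i\<in>{1..min m D}. sets (vimage_algebra ?\<Omega> (\<lambda>y. y i) (borel :: real measure))) \<union>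
      sets (vimage_algebra ?\<Omega> (\<lambda>y. (L2_set y {1..D})\<^sup>2) borel)"
  have "G \<subseteq> Pow ?\<Omega>"
    using sets_vimage_algebra_subset unfolding G_def by blast
  moreover have "residual_filtration D m = sigma ?\<Omega> G"
    by (simp only: residual_filtration_def Let_def G_def)
  ultimately have B: "B \<in> sigma_sets ?\<Omega> G"
    using assms by simp
  have L2[measurable]: "(\<lambda>y. (L2_set y {1..D})\<^sup>2) \<in> borel_measurable (data_space D)"
    unfolding L2_set_def data_space_def by measurable
  have coord: "(\<lambda>y. y i) \<in> borel_measurable (data_space D)" if "i \<in> {1..D}" for i
    unfolding data_space_def using that by measurable
  have G: "A \<in> sets (data_space D)" if "A \<in> G" for A
    using that unfolding G_def
  proof (elim UnE UN_E)
    fix i assume "i \<in> {1..min m D}" "A \<in> sets (vimage_algebra ?\<Omega> (\<lambda>y. y i) (borel :: real measure))"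
    then show ?thesis
      using coord[of i] by (auto simp: in_vimage_algebra sets_vimage_algebra2 intro!: measurable_sets)
  next
    assume "A \<in> sets (vimage_algebra ?\<Omega> (\<lambda>y. (L2_set y {1..D})\<^sup>2) borel)"
    then show ?thesis
      using measurable_sets[OF L2] by (auto simp: sets_vimage_algebra2)
  qed
  show "B \<in> sets (data_space D)"
    using B
    by (induction rule: sigma_sets.induct) (auto intro: G)
  assume m: "m < D"
  show "radial_in {1..D} {Suc m..D} (\<lambda>y. y \<in> B)"
    unfolding radial_in_def
  proof (intro ballI impI)
    fix y y' :: "nat \<Rightarrow> real"
    assume y: "y \<in> extensional {1..D}" "y' \<in> extensional {1..D}"
      and eq: "\<forall>i\<in>{1..D} - {Suc m..D}. y i = y' i" "(\<Sum>i\<in>{Suc m..D}. (y i)\<^sup>2) = (\<Sum>i\<in>{Suc m..D}. (y' i)\<^sup>2)"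
    have space: "y \<in> ?\<Omega>" "y' \<in> ?\<Omega>" using y by (auto simp: space_data_space PiE_def)
    have split: "{1..D} = {1..m} \<union> {Suc m..D}" using m by auto
    have low: "y i = y' i" if "i \<in> {1..m}" for i
      using eq(1) that m by auto
    have "(\<Sum>i=1..D. (z i)\<^sup>2) = (\<Sum>i=1..m. (z i)\<^sup>2) + (\<Sum>i=Suc m..D. (z i)\<^sup>2)" for z :: "nat \<Rightarrow> real"
      unfolding split by (rule sum.union_disjoint) auto
    then have norm: "(\<Sum>i=1..D. (y i)\<^sup>2) = (\<Sum>i=1..D. (y' i)\<^sup>2)"
      using eq(2) low by simp
    show "(y \<in> B) = (y' \<in> B)"
      using B
    proof (induction rule: sigma_sets.induct)
      case (Basic A)
      then show ?case
        unfolding G_def using low norm space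
        by (auto simp: sets_vimage_algebra2 L2_set_def)
    next
      case (Compl A)
      then show ?case using space by auto
    qed auto
  qed
qed

text \<open>
  The event \<open>m \<le> \<tau>\<close> is the complement of \<open>\<tau> \<le> m - 1\<close> and is thus known at time \<open>m - 1\<close>, before coordinate
  \<open>m\<close> is revealed: this is why the norm may run over all of \<open>{m..D}\<close>.
\<close>

lemma residual_rule_late_event:
  assumes \<tau>: "residual_rule D \<tau>" and m: "1 \<le> m" "m \<le> D"
  shows "{y \<in> space (data_space D). m \<le> \<tau> y} \<in> sets (data_space D)"
    and "radial_in {1..D} {m..D} (\<lambda>y. y \<in> {y \<in> space (data_space D). m \<le> \<tau> y})"
proof -
  interpret filtration "space (data_space D)" "residual_filtration D"
    by (rule filtration_residual_filtration)
  have "Measurable.pred (residual_filtration D (m - 1)) (\<lambda>y. m - 1 < \<tau> y)"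
    using \<tau> by (intro stopping_timeD2) (simp add: residual_rule_def)
  then have "{y \<in> space (data_space D). m \<le> \<tau> y} \<in> sets (residual_filtration D (m - 1))"
    using m by (simp add: pred_def space_F less_eq_Suc_le)
  from residual_filtration_sets[OF this] m
  show "{y \<in> space (data_space D). m \<le> \<tau> y} \<in> sets (data_space D)"
    "radial_in {1..D} {m..D} (\<lambda>y. y \<in> {y \<in> space (data_space D). m \<le> \<tau> y})"
    by auto
qed

lemma square_sum_le: "(a + b)\<^sup>2 \<le> 2 * a\<^sup>2 + 2 * (b::real)\<^sup>2"
  using zero_le_power2[of "a - b"] by (simp add: power2_eq_square algebra_simps)

lemma borel_measurable_loss:
  assumes \<tau>: "residual_rule D \<tau>"
  shows "(\<lambda>y. \<Sum>i=1..D. (tsvd lam (\<tau> y) y i - \<mu> i)\<^sup>2) \<in> borel_measurable (data_space D)"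
proof (intro borel_measurable_sum borel_measurable_power borel_measurable_diff borel_measurable_const)
  fix i assume i: "i \<in> {1..D}"
  have [measurable]: "Measurable.pred (data_space D) (\<lambda>y. i \<le> \<tau> y)"
    using residual_rule_late_event(1)[OF \<tau>, of i] i by (simp add: pred_def)
  have [measurable]: "(\<lambda>y. y i) \<in> borel_measurable (data_space D)"
    unfolding data_space_def using i by measurable
  show "(\<lambda>y. tsvd lam (\<tau> y) y i) \<in> borel_measurable (data_space D)"
    unfolding tsvd_def by measurable
qed

text \<open>
  The loss is dominated by a quadratic function of the noise. Its integrability has to be checked, since
  the Bochner integral in the definition of the risk would otherwise be \<open>0\<close>.
\<close>

lemma risk_square:
  assumes \<tau>: "residual_rule D \<tau>"
  shows "ennreal ((risk D \<delta> lam \<mu> \<tau>)\<^sup>2)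
    = (\<integral>\<^sup>+y. ennreal (\<Sum>i=1..D. (tsvd lam (\<tau> y) y i - \<mu> i)\<^sup>2) \<partial>obs_law D \<delta> lam \<mu>)"
proof -
  define loss where "loss y = (\<Sum>i=1..D. (tsvd lam (\<tau> y) y i - \<mu> i)\<^sup>2)" for y
  have loss0: "loss y \<ge> 0" for y by (simp add: loss_def sum_nonneg)
  have meas: "loss \<in> borel_measurable (data_space D)"
    unfolding loss_def by (rule borel_measurable_loss[OF \<tau>])
  have meas': "loss \<in> borel_measurable (obs_law D \<delta> lam \<mu>)"
    using meas by (simp add: obs_law_def)
  have risk: "risk D \<delta> lam \<mu> \<tau> = sqrt (\<integral>y. loss y \<partial>obs_law D \<delta> lam \<mu>)"
    unfolding risk_def loss_def by (simp add: L2_set_def sum_nonneg)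
  define C where "C = (\<Sum>i=1..D. 4 * (inverse (lam i))\<^sup>2 * (lam i * \<mu> i)\<^sup>2 + 2 * (\<mu> i)\<^sup>2)"
  define d where "d i = 4 * (inverse (lam i))\<^sup>2 * \<delta>\<^sup>2" for i
  have C0: "C \<ge> 0" by (auto simp: C_def intro!: sum_nonneg)
  have d0: "d i \<ge> 0" for i by (simp add: d_def)
  have bound: "loss (\<lambda>i\<in>{1..D}. lam i * \<mu> i + \<delta> * \<epsilon> i) \<le> C + (\<Sum>i=1..D. d i * (\<epsilon> i)\<^sup>2)" for \<epsilon>
  proof -
    have "(tsvd lam m (\<lambda>i\<in>{1..D}. lam i * \<mu> i + \<delta> * \<epsilon> i) i - \<mu> i)\<^sup>2
        \<le> (4 * (inverse (lam i))\<^sup>2 * (lam i * \<mu> i)\<^sup>2 + 2 * (\<mu> i)\<^sup>2) + d i * (\<epsilon> i)\<^sup>2" if i: "i \<in> {1..D}" for m i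
    proof -
      have "(tsvd lam m (\<lambda>i\<in>{1..D}. lam i * \<mu> i + \<delta> * \<epsilon> i) i - \<mu> i)\<^sup>2
          \<le> 2 * (tsvd lam m (\<lambda>i\<in>{1..D}. lam i * \<mu> i + \<delta> * \<epsilon> i) i)\<^sup>2 + 2 * (\<mu> i)\<^sup>2"
        using square_sum_le[of "tsvd lam m (\<lambda>i\<in>{1..D}. lam i * \<mu> i + \<delta> * \<epsilon> i) i" "- \<mu> i"] by simp
      also have "(tsvd lam m (\<lambda>i\<in>{1..D}. lam i * \<mu> i + \<delta> * \<epsilon> i) i)\<^sup>2 \<le> (inverse (lam i))\<^sup>2 * (lam i * \<mu> i + \<delta> * \<epsilon> i)\<^sup>2"
        using i by (simp add: tsvd_def power_mult_distrib)
      also have "\<dots> \<le> (inverse (lam i))\<^sup>2 * (2 * (lam i * \<mu> i)\<^sup>2 + 2 * (\<delta> * \<epsilon> i)\<^sup>2)"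
        by (intro mult_left_mono square_sum_le) simp
      finally show ?thesis
        by (simp add: d_def power_mult_distrib algebra_simps)
    qed
    then show ?thesis
      unfolding loss_def C_def by (subst sum.distrib[symmetric]) (rule sum_mono, blast)
  qed
  have sq: "(\<integral>\<^sup>+\<epsilon>. ennreal ((\<epsilon> i)\<^sup>2) \<partial>gauss {1..D}) < \<infinity>" if i: "i \<in> {1..D}" for i
  proof -
    have "(\<integral>\<^sup>+\<epsilon>. ennreal ((\<epsilon> i)\<^sup>2) \<partial>gauss {1..D}) = (\<integral>\<^sup>+x. ennreal (x\<^sup>2) \<partial>std_normal)"
      using i by (intro nn_integral_gauss_component) auto
    also have "\<dots> = (\<integral>\<^sup>+x. ennreal (std_normal_density x * x\<^sup>2) \<partial>lborel)"
      by (subst nn_integral_density) (auto simp: ennreal_mult)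
    also have "\<dots> < \<infinity>"
      using integrable_std_normal_moment[of 2] by (auto simp: integrable_iff_bounded)
    finally show ?thesis .
  qed
  have "(\<integral>\<^sup>+y. ennreal (loss y) \<partial>obs_law D \<delta> lam \<mu>)
      = (\<integral>\<^sup>+\<epsilon>. ennreal (loss (\<lambda>i\<in>{1..D}. lam i * \<mu> i + \<delta> * \<epsilon> i)) \<partial>gauss {1..D})"
    using meas by (intro nn_integral_obs_law) simp
  also have "\<dots> \<le> (\<integral>\<^sup>+\<epsilon>. ennreal C + (\<Sum>i=1..D. ennreal (d i) * ennreal ((\<epsilon> i)\<^sup>2)) \<partial>gauss {1..D})"
  proof (rule nn_integral_mono)
    fix \<epsilon> :: "nat \<Rightarrow> real"
    have "ennreal (loss (\<lambda>i\<in>{1..D}. lam i * \<mu> i + \<delta> * \<epsilon> i)) \<le> ennreal (C + (\<Sum>i=1..D. d i * (\<epsilon> i)\<^sup>2))"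
      by (intro ennreal_leI bound)
    also have "\<dots> = ennreal C + (\<Sum>i=1..D. ennreal (d i) * ennreal ((\<epsilon> i)\<^sup>2))"
      using C0 d0 by (simp add: ennreal_plus sum_nonneg sum_ennreal[symmetric] ennreal_mult)
    finally show "ennreal (loss (\<lambda>i\<in>{1..D}. lam i * \<mu> i + \<delta> * \<epsilon> i)) \<le> \<dots>" .
  qed
  also have "\<dots> = ennreal C + (\<Sum>i=1..D. ennreal (d i) * (\<integral>\<^sup>+\<epsilon>. ennreal ((\<epsilon> i)\<^sup>2) \<partial>gauss {1..D}))"
    using prob_space.emeasure_space_1[OF prob_space_gauss]
    by (subst nn_integral_add) (auto simp: nn_integral_sum nn_integral_cmult)
  also have "\<dots> < \<infinity>"
    using sq by (auto simp: ennreal_mult_less_top)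
  finally have fin: "(\<integral>\<^sup>+y. ennreal (loss y) \<partial>obs_law D \<delta> lam \<mu>) < \<infinity>" .
  have "integrable (obs_law D \<delta> lam \<mu>) loss"
    using fin meas' loss0 by (intro integrableI_nonneg) auto
  then have "(\<integral>\<^sup>+y. ennreal (loss y) \<partial>obs_law D \<delta> lam \<mu>) = ennreal (\<integral>y. loss y \<partial>obs_law D \<delta> lam \<mu>)"
    using loss0 by (intro nn_integral_eq_integral) auto
  also have "\<dots> = ennreal ((risk D \<delta> lam \<mu> \<tau>)\<^sup>2)"
    using loss0 by (simp add: risk)
  finally show ?thesis by (simp add: loss_def)
qed

section \<open>The truncation level\<close>

text \<open>
  The upper half of the range contributes at least \<open>m / 2\<close> terms, each of them at least \<open>(m / 2) powr q\<close>.
\<close>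

lemma sum_powr_ge:
  fixes q :: real
  assumes "q \<ge> 0"
  shows "(real m / 2) powr (q + 1) \<le> (\<Sum>i=1..m. real i powr q)"
proof (cases "m = 0")
  case False
  define l where "l = (m + 1) div 2"
  have l: "real m / 2 \<le> real l" "1 \<le> l" "l \<le> m" "real m / 2 \<le> real (Suc m - l)"
    using False by (auto simp: l_def)
  have "(real m / 2) powr (q + 1) = (real m / 2) * (real m / 2) powr q"
    using False by (simp add: powr_add)
  also have "\<dots> \<le> real (card {l..m}) * (real m / 2) powr q"
    using l by (intro mult_right_mono) auto
  also have "\<dots> = (\<Sum>i\<in>{l..m}. (real m / 2) powr q)"
    by simp
  also have "\<dots> \<le> (\<Sum>i\<in>{l..m}. real i powr q)"
    using l assms by (intro sum_mono powr_mono2) auto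
  also have "\<dots> \<le> (\<Sum>i=1..m. real i powr q)"
    using l by (intro sum_mono2) auto
  finally show ?thesis .
qed simp

text \<open>
  Here \<open>y\<close> and \<open>z\<close> stand for \<open>R'\<^sup>-\<^sup>1\<delta>\<close> and \<open>R\<^sup>-\<^sup>1\<delta>\<close>. The third property of \<open>m\<close> makes the variance at level \<open>m\<close>
  exceed the assumed risk, the fourth makes a spike of size \<open>R' m powr (- \<alpha>)\<close> at \<open>m\<close> undetectable, and the
  last says that such a spike has the claimed size. The lower bound on \<open>D\<close> is what makes the third and
  fourth properties compatible with \<open>2 * m \<le> D\<close>. If \<open>\<alpha> + p = 0\<close>, then \<open>i1 = x powr 0 = 1\<close>, and the fourth property reduces to
  \<open>1 \<le> x\<close>, which the bound on \<open>D\<close> gives as well.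
\<close>

lemma truncation_level:
  fixes \<alpha> \<beta> p K y z :: real and D :: nat
  assumes \<alpha>: "\<alpha> \<ge> 0" "\<alpha> \<le> \<beta>" and p: "p \<ge> 0" and K: "K \<ge> 1"
    and yz: "0 < y" "y \<le> z" "z \<le> 1"
    and D: "4 * K * y powr (- 1 / (\<alpha> + p + 1 / 4)) \<le> real D"
  obtains m :: nat where "1 \<le> m" "2 * m \<le> D"
    "K * z powr (- 2 / (2 * \<beta> + 2 * p + 1)) \<le> real m"
    "real m powr (- (\<alpha> + p)) \<le> y * real D powr (1 / 4)"
    "(2 * K) powr (- \<alpha>) * min ((y * real D powr (1 / 4)) powr (2 * \<alpha> / (2 * \<alpha> + 2 * p)))
        (z powr (2 * \<alpha> / (2 * \<beta> + 2 * p + 1))) \<le> real m powr (- \<alpha>)"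
proof -
  define s where "s = \<alpha> + p"
  have s: "s \<ge> 0" using \<alpha> p by (simp add: s_def)
  define T where "T = y powr (- 1 / (s + 1 / 4))"
  define t where "t = z powr (- 2 / (2 * \<beta> + 2 * p + 1))"
  define x where "x = y * real D powr (1 / 4)"
  define i1 where "i1 = x powr (- 1 / s)"
  define M where "M = max (K * t) i1"
  define m where "m = nat \<lceil>M\<rceil>"
  have t1: "t \<ge> 1"
    unfolding t_def using yz \<alpha> p powr_mono'[of "- 2 / (2 * \<beta> + 2 * p + 1)" 0 z]
    by (simp add: divide_nonpos_nonneg)
  have "t \<le> z powr (- 1 / (s + 1 / 4))"
    unfolding t_def using yz \<alpha> p by (intro powr_mono') (auto simp: s_def field_simps)
  also have "\<dots> \<le> T"
    unfolding T_def using yz s by (intro powr_mono2') (auto simp: divide_nonpos_pos)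
  finally have tT: "t \<le> T" .
  have DT: "4 * (K * T) \<le> real D" using D by (simp add: T_def s_def)
  have "1 * T \<le> K * T" using K tT t1 by (intro mult_right_mono) auto
  then have D4T: "T \<le> real D / 4" using DT by simp
  then have D4: "1 \<le> real D / 4" using tT t1 by simp
  have Kt: "K * t \<le> real D / 4"
  proof -
    have "K * t \<le> K * T" using tT K by (intro mult_left_mono) auto
    then show ?thesis using DT by linarith
  qed
  have Kt1: "1 \<le> K * t"
    using mult_mono[of 1 K 1 t] K t1 by simp
  \<comment> \<open>solve the dimension condition for \<open>y\<close>\<close>
  have xD: "(real D / 4) powr (- s) \<le> x"
  proof -
    have "(real D / 4) powr (- s) = (real D / 4) powr (- (s + 1 / 4)) * (real D / 4) powr (1 / 4)"
      by (simp add: powr_add[symmetric])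
    also have "\<dots> \<le> T powr (- (s + 1 / 4)) * (real D / 4) powr (1 / 4)"
      using D4T tT t1 s by (intro mult_right_mono powr_mono2') auto
    also have "T powr (- (s + 1 / 4)) = y"
    proof -
      have "(- 1 / e) * (- e) = 1" if "e > 0" for e :: real
        using that by simp
      from this[of "s + 1 / 4"] have "(- 1 / (s + 1 / 4)) * (- (s + 1 / 4)) = 1"
        using s by linarith
      then show ?thesis unfolding T_def powr_powr using yz by simp
    qed
    also have "y * (real D / 4) powr (1 / 4) \<le> x"
      unfolding x_def using yz by (intro mult_left_mono powr_mono2) auto
    finally show ?thesis by simp
  qed
  have x0: "x > 0" using yz D4 by (simp add: x_def)
  have i1D: "i1 \<le> real D / 4"
  proof (cases "s = 0")
    case False
    have "i1 \<le> ((real D / 4) powr (- s)) powr (- 1 / s)"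
      unfolding i1_def using xD D4 s False by (intro powr_mono2') (auto simp: divide_nonpos_pos)
    also have "\<dots> = real D / 4" using False D4 by (simp add: powr_powr)
    finally show ?thesis .
  qed (use x0 D4 in \<open>simp add: i1_def\<close>)
  have M: "1 \<le> M" "M \<le> real D / 4"
    using Kt Kt1 i1D by (auto simp: M_def)
  have m: "M \<le> real m" "real m \<le> 2 * M"
    using M by (auto simp: m_def) linarith+
  have i10: "i1 > 0" using x0 by (simp add: i1_def)
  show thesis
  proof (rule that[of m])
    show "1 \<le> m" using m M by linarith
    have "real (2 * m) \<le> real D" using m M by simp
    then show "2 * m \<le> D" by (simp only: of_nat_le_iff)
    show "K * z powr (- 2 / (2 * \<beta> + 2 * p + 1)) \<le> real m"
      using m(1) by (simp add: M_def t_def)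
    have "real m powr (- s) \<le> x"
    proof (cases "s = 0")
      case True
      then show ?thesis using xD D4 m M by auto
    next
      case False
      have "real m powr (- s) \<le> i1 powr (- s)"
        using m(1) i10 s by (intro powr_mono2') (auto simp: M_def)
      also have "\<dots> = x" using False x0 by (simp add: i1_def powr_powr)
      finally show ?thesis .
    qed
    then show "real m powr (- (\<alpha> + p)) \<le> y * real D powr (1 / 4)"
      by (simp add: s_def x_def)
    let ?min = "min (x powr (2 * \<alpha> / (2 * \<alpha> + 2 * p))) (z powr (2 * \<alpha> / (2 * \<beta> + 2 * p + 1)))"
    have "(2 * K) powr (- \<alpha>) * ?min \<le> (2 * M) powr (- \<alpha>)"
    proof (cases "i1 \<le> K * t")
      case True
      have "?min \<le> z powr (2 * \<alpha> / (2 * \<beta> + 2 * p + 1))" by simp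
      also have "\<dots> = t powr (- \<alpha>)"
        by (simp add: t_def powr_powr mult.commute)
      finally have "(2 * K) powr (- \<alpha>) * ?min \<le> (2 * K) powr (- \<alpha>) * t powr (- \<alpha>)"
        by (intro mult_left_mono) auto
      also have "\<dots> = (2 * M) powr (- \<alpha>)"
        using True K t1 by (simp add: M_def powr_mult[symmetric] mult.assoc)
      finally show ?thesis .
    next
      case False
      have "?min \<le> x powr (2 * \<alpha> / (2 * \<alpha> + 2 * p))" by simp
      also have "\<dots> = x powr (\<alpha> / s)"
        using mult_divide_mult_cancel_left[of 2 \<alpha> s] by (simp add: s_def)
      also have "\<dots> = i1 powr (- \<alpha>)"
        by (simp add: i1_def powr_powr)
      finally have "(2 * K) powr (- \<alpha>) * ?min \<le> 2 powr (- \<alpha>) * i1 powr (- \<alpha>)"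
        using K \<alpha> by (intro mult_mono powr_mono2') auto
      also have "\<dots> = (2 * M) powr (- \<alpha>)"
        using False i10 by (simp add: M_def powr_mult)
      finally show ?thesis .
    qed
    also have "\<dots> \<le> real m powr (- \<alpha>)"
      using m M \<alpha> by (intro powr_mono2') auto
    finally show "(2 * K) powr (- \<alpha>) * min ((y * real D powr (1 / 4)) powr (2 * \<alpha> / (2 * \<alpha> + 2 * p)))
        (z powr (2 * \<alpha> / (2 * \<beta> + 2 * p + 1))) \<le> real m powr (- \<alpha>)"
      by (simp add: x_def)
  qed
qed

section \<open>Accuracy at one signal forces a large risk at another\<close>

text \<open>
  If the risk at \<open>\<mu>\<close> is far below the variance at level \<open>m\<close>, the rule stops at \<open>m\<close> or later with probability
  at most \<open>1/8\<close> under \<open>\<mu>\<close>. The signal \<open>\<mu>'\<close> agrees with \<open>\<mu>\<close> before \<open>m\<close> and its excess energy after that is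
  hidden in the fluctuations of the noise, so under \<open>\<mu>'\<close> the probability is at most
  \<open>2/8 + exp (1/8) / 8 \<le> 1/2\<close>. If the rule stops before \<open>m\<close>, all coordinates from \<open>m\<close> on are estimated by \<open>0\<close>.
\<close>

proposition risk_lower_bound:
  assumes \<tau>: "residual_rule D \<tau>" and \<delta>: "\<delta> > 0" and lam: "\<And>i. i \<in> {1..D} \<Longrightarrow> lam i > 0"
    and m: "1 \<le> m" "m < D"
    and head: "\<And>i. 1 \<le> i \<Longrightarrow> i < m \<Longrightarrow> \<mu>' i = \<mu> i"
    and energy: "(\<Sum>i=m..D. (lam i * \<mu>' i)\<^sup>2) = (\<Sum>i=m..D. (lam i * \<mu> i)\<^sup>2) + (\<delta> * h)\<^sup>2"
    and h: "8 * h ^ 4 \<le> real (D - m)"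
    and small: "(risk D \<delta> lam \<mu> \<tau>)\<^sup>2 < \<delta>\<^sup>2 * (\<Sum>i=1..m. (inverse (lam i))\<^sup>2) / 4096"
  shows "(\<Sum>i=m..D. (\<mu>' i)\<^sup>2) / 2 \<le> (risk D \<delta> lam \<mu>' \<tau>)\<^sup>2"
proof -
  define B where "B = {y \<in> space (data_space D). m \<le> \<tau> y}"
  have B: "B \<in> sets (data_space D)" and radial: "radial_in {1..D} {m..D} (\<lambda>y. y \<in> B)"
    using residual_rule_late_event[OF \<tau>, of m] m by (auto simp: B_def)
  let ?I = "{1..D}"
  have event: "emeasure (obs_law D \<delta> lam \<mu>) B \<le> ennreal (1/8)"
  proof (rule ccontr)
    let ?Y = "\<lambda>\<epsilon>. \<lambda>i\<in>?I. lam i * \<mu> i + \<delta> * \<epsilon> i"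
    let ?w = "\<lambda>i. \<delta>\<^sup>2 * (inverse (lam i))\<^sup>2"
    assume "\<not> emeasure (obs_law D \<delta> lam \<mu>) B \<le> ennreal (1/8)"
    moreover define E where "E = ?Y -` B \<inter> space (gauss ?I)"
    moreover have "emeasure (obs_law D \<delta> lam \<mu>) B = emeasure (gauss ?I) E"
      unfolding obs_law_def noise_def E_def by (rule emeasure_distr[OF observation_measurable B])
    ultimately have prob: "ennreal (1/8) \<le> emeasure (gauss ?I) E" by simp
    have "E \<in> sets (gauss ?I)"
      unfolding E_def by (rule measurable_sets[OF observation_measurable B])
    then have E: "E \<in> sets (Pi\<^sub>M ?I (\<lambda>_. borel))" by (simp add: sets_gauss)
    have "ennreal ((\<Sum>i=1..m. ?w i) / 4096) \<le> (\<integral>\<^sup>+\<epsilon>. indicator E \<epsilon> * ennreal (\<Sum>i=1..m. ?w i * (\<epsilon> i)\<^sup>2) \<partial>gauss ?I)"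
      using m by (intro noise_energy_on_event E prob) auto
    also have "\<dots> \<le> (\<integral>\<^sup>+\<epsilon>. ennreal (\<Sum>i=1..D. (tsvd lam (\<tau> (?Y \<epsilon>)) (?Y \<epsilon>) i - \<mu> i)\<^sup>2) \<partial>gauss ?I)"
    proof (rule nn_integral_mono)
      fix \<epsilon> :: "nat \<Rightarrow> real"
      have "(\<Sum>i=1..m. ?w i * (\<epsilon> i)\<^sup>2) \<le> (\<Sum>i=1..D. (tsvd lam (\<tau> (?Y \<epsilon>)) (?Y \<epsilon>) i - \<mu> i)\<^sup>2)" if "\<epsilon> \<in> E"
      proof -
        have late: "m \<le> \<tau> (?Y \<epsilon>)" using that by (auto simp: E_def B_def)
        have "?w i * (\<epsilon> i)\<^sup>2 = (tsvd lam (\<tau> (?Y \<epsilon>)) (?Y \<epsilon>) i - \<mu> i)\<^sup>2" if i: "i \<in> {1..m}" for i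
        proof -
          have "lam i \<noteq> 0" "i \<in> ?I" "i \<le> \<tau> (?Y \<epsilon>)" using lam[of i] i m late by auto
          then have "tsvd lam (\<tau> (?Y \<epsilon>)) (?Y \<epsilon>) i - \<mu> i = \<delta> * inverse (lam i) * \<epsilon> i"
            by (simp add: tsvd_def field_simps)
          then show ?thesis by (simp add: power_mult_distrib)
        qed
        then have "(\<Sum>i=1..m. ?w i * (\<epsilon> i)\<^sup>2) = (\<Sum>i=1..m. (tsvd lam (\<tau> (?Y \<epsilon>)) (?Y \<epsilon>) i - \<mu> i)\<^sup>2)"
          by (intro sum.cong) auto
        also have "\<dots> \<le> (\<Sum>i=1..D. (tsvd lam (\<tau> (?Y \<epsilon>)) (?Y \<epsilon>) i - \<mu> i)\<^sup>2)"
          using m by (intro sum_mono2) auto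
        finally show ?thesis .
      qed
      then show "indicator E \<epsilon> * ennreal (\<Sum>i=1..m. ?w i * (\<epsilon> i)\<^sup>2)
          \<le> ennreal (\<Sum>i=1..D. (tsvd lam (\<tau> (?Y \<epsilon>)) (?Y \<epsilon>) i - \<mu> i)\<^sup>2)"
        by (auto simp: indicator_def intro: ennreal_leI)
    qed
    also have "\<dots> = ennreal ((risk D \<delta> lam \<mu> \<tau>)\<^sup>2)"
      unfolding risk_square[OF \<tau>] by (intro nn_integral_obs_law[symmetric] borel_measurable_loss[OF \<tau>] measurable_compose[OF _ measurable_ennreal])
    finally have "(\<Sum>i=1..m. ?w i) / 4096 \<le> (risk D \<delta> lam \<mu> \<tau>)\<^sup>2"
      by (subst (asm) ennreal_le_iff) auto
    then show False using small by (simp add: sum_distrib_left)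
  qed
  define B' where "B' = {y \<in> extensional ?I. (\<lambda>i\<in>?I. \<delta> * y i) \<in> B}"
  have "B' \<in> sets (Pi\<^sub>M ?I (\<lambda>_. borel))"
  proof -
    have "(\<lambda>y. \<lambda>i\<in>?I. \<delta> * y i) \<in> Pi\<^sub>M ?I (\<lambda>_. borel :: real measure) \<rightarrow>\<^sub>M data_space D"
      unfolding data_space_def by measurable
    from measurable_sets[OF this B] show ?thesis
      by (simp add: B'_def vimage_def space_PiM PiE_def Int_def conj_commute)
  qed
  moreover have "radial_in ?I {m..D} (\<lambda>y. y \<in> B')"
    unfolding radial_in_def
  proof (intro ballI impI)
    fix y y' :: "nat \<Rightarrow> real"
    assume y: "y \<in> extensional ?I" "y' \<in> extensional ?I" and eq: "\<forall>i\<in>?I - {m..D}. y i = y' i"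
      "(\<Sum>i=m..D. (y i)\<^sup>2) = (\<Sum>i=m..D. (y' i)\<^sup>2)"
    have "(\<Sum>i=m..D. ((\<lambda>i\<in>?I. \<delta> * z i) i)\<^sup>2) = \<delta>\<^sup>2 * (\<Sum>i=m..D. (z i)\<^sup>2)" for z :: "nat \<Rightarrow> real"
      unfolding sum_distrib_left using m by (intro sum.cong) (auto simp: power_mult_distrib)
    then have "((\<lambda>i\<in>?I. \<delta> * y i) \<in> B) = ((\<lambda>i\<in>?I. \<delta> * y' i) \<in> B)"
      using eq m by (intro radial_inD[OF radial]) (auto simp del: One_nat_def)
    then show "(y \<in> B') = (y' \<in> B')" using y by (simp add: B'_def)
  qed
  moreover have "(\<Sum>i=m..D. (lam i * \<mu>' i / \<delta>)\<^sup>2) = (\<Sum>i=m..D. (lam i * \<mu> i / \<delta>)\<^sup>2) + h\<^sup>2"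
    using energy \<delta> by (simp add: power_divide sum_divide_distrib[symmetric] power_mult_distrib field_simps)
  moreover have "h ^ 4 \<le> real (D - m)" using h zero_le_even_power[of 4 h] by simp
  ultimately have "shifted_mean ?I (indicator B') (\<lambda>i. lam i * \<mu>' i / \<delta>)
      \<le> 2 * shifted_mean ?I (indicator B') (\<lambda>i. lam i * \<mu> i / \<delta>) + ennreal (exp (h ^ 4 / real (D - m)) / 8)"
    using m head by (intro shifted_mean_energy_perturbation[where J="{m..D}"]) auto
  then have "emeasure (obs_law D \<delta> lam \<mu>') B \<le> 2 * emeasure (obs_law D \<delta> lam \<mu>) B + ennreal (exp (h ^ 4 / real (D - m)) / 8)"
    using \<delta> B by (simp add: emeasure_obs_law B'_def)
  also have "\<dots> \<le> 2 * ennreal (1/8) + ennreal (2 / 8)"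
  proof (intro add_mono mult_left_mono event ennreal_leI divide_right_mono)
    have "h ^ 4 / real (D - m) \<le> 1/8" using h m by (simp add: field_simps)
    then have "exp (h ^ 4 / real (D - m)) \<le> exp (1/8)" by simp
    also have "\<dots> \<le> 2" using exp_bound[of "1/8"] by (simp add: power2_eq_square)
    finally show "exp (h ^ 4 / real (D - m)) \<le> 2" .
  qed auto
  also have "\<dots> = ennreal 2 * ennreal (1/8) + ennreal (2 / 8)" by simp
  also have "\<dots> = ennreal (1/2)"
    by (subst ennreal_mult[symmetric], simp, simp, subst ennreal_plus[symmetric]) auto
  finally have late': "emeasure (obs_law D \<delta> lam \<mu>') B \<le> ennreal (1/2)" .
  interpret P: prob_space "obs_law D \<delta> lam \<mu>'" by (rule prob_space_obs_law)
  have sp: "space (obs_law D \<delta> lam \<mu>') = space (data_space D)" by (simp add: obs_law_def)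
  have BM[measurable]: "B \<in> sets (obs_law D \<delta> lam \<mu>')" using B by (simp add: obs_law_def)
  define b where "b = (\<Sum>i=m..D. (\<mu>' i)\<^sup>2)"
  have b0: "b \<ge> 0" by (simp add: b_def sum_nonneg)
  define A where "A = space (data_space D) - B"
  have AM[measurable]: "A \<in> sets (obs_law D \<delta> lam \<mu>')"
    unfolding A_def sp[symmetric] by measurable
  have "P.prob B \<le> 1/2" using late' unfolding P.emeasure_eq_measure by (subst (asm) ennreal_le_iff) auto
  then have half: "1/2 \<le> P.prob A"
    using P.prob_compl[OF BM] by (simp add: A_def sp)
  have "ennreal (b / 2) \<le> ennreal b * ennreal (P.prob A)"
    using half b0 mult_left_mono[OF half b0] by (simp add: ennreal_mult[symmetric] ennreal_leI)
  also have "\<dots> = (\<integral>\<^sup>+y. ennreal b * indicator A y \<partial>obs_law D \<delta> lam \<mu>')"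
    by (simp add: nn_integral_cmult_indicator P.emeasure_eq_measure)
  also have "\<dots> \<le> (\<integral>\<^sup>+y. ennreal (\<Sum>i=1..D. (tsvd lam (\<tau> y) y i - \<mu>' i)\<^sup>2) \<partial>obs_law D \<delta> lam \<mu>')"
  proof (rule nn_integral_mono)
    fix y
    have "b \<le> (\<Sum>i=1..D. (tsvd lam (\<tau> y) y i - \<mu>' i)\<^sup>2)" if y: "y \<in> A"
    proof -
      have "\<tau> y < m" using y by (auto simp: A_def B_def)
      then have "b = (\<Sum>i=m..D. (tsvd lam (\<tau> y) y i - \<mu>' i)\<^sup>2)"
        unfolding b_def by (intro sum.cong) (auto simp: tsvd_def)
      also have "\<dots> \<le> (\<Sum>i=1..D. (tsvd lam (\<tau> y) y i - \<mu>' i)\<^sup>2)"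
        using m by (intro sum_mono2) auto
      finally show ?thesis .
    qed
    then show "ennreal b * indicator A y \<le> ennreal (\<Sum>i=1..D. (tsvd lam (\<tau> y) y i - \<mu>' i)\<^sup>2)"
      by (auto simp: indicator_def intro: ennreal_leI)
  qed
  also have "\<dots> = ennreal ((risk D \<delta> lam \<mu>' \<tau>)\<^sup>2)"
    by (rule risk_square[OF \<tau>, symmetric])
  finally show ?thesis
    by (simp add: b_def)
qed

theorem corollary2p5:
  fixes C\<^sub>\<mu> C\<^sub>A \<alpha> p :: real
  assumes "C\<^sub>A \<ge> 1" and "\<alpha> \<ge> 0" and "p \<ge> 0"
  shows "\<exists>c\<^sub>1>0. \<exists>c\<^sub>2\<in>{0<..1}. \<exists>c\<^sub>3>0.
    \<forall>(D::nat) (\<delta>::real) (lam::nat \<Rightarrow> real) (\<beta>::real) (R::real) (R'::real)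
      (\<tau>::(nat \<Rightarrow> real) \<Rightarrow> nat).
      D \<ge> 1 \<longrightarrow> \<delta> > 0 \<longrightarrow>
      (\<forall>i\<in>{1..D}. lam i > 0) \<longrightarrow>
      (\<forall>i\<in>{1..D}. \<forall>j\<in>{1..D}. i \<le> j \<longrightarrow> lam j \<le> lam i) \<longrightarrow>
      (\<forall>i\<in>{1..D}. inverse C\<^sub>A * real i powr (- p) \<le> lam i \<and> lam i \<le> C\<^sub>A * real i powr (- p)) \<longrightarrow>
      R > 0 \<longrightarrow> \<alpha> \<le> \<beta> \<longrightarrow> R' \<ge> 2 * R \<longrightarrow>
      residual_rule D \<tau> \<longrightarrow>
      (\<exists>\<mu>\<in>sobolev_ellipsoid \<beta> R D. risk D \<delta> lam \<mu> \<tau> \<le> C\<^sub>\<mu> * minimax_rate \<beta> p R \<delta>) \<longrightarrow>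
      inverse R * \<delta> \<le> c\<^sub>2 \<longrightarrow>
      real D \<ge> c\<^sub>3 * time_scale (\<alpha> - 1 / 4) p R' \<delta> \<longrightarrow>
      (\<exists>\<mu>'\<in>sobolev_ellipsoid \<alpha> R' D.
         risk D \<delta> lam \<mu>' \<tau> \<ge>
           c\<^sub>1 * R' * min ((inverse R' * \<delta> * real D powr (1 / 4)) powr (2 * \<alpha> / (2 * \<alpha> + 2 * p)))
                         ((inverse R * \<delta>) powr (2 * \<alpha> / (2 * \<beta> + 2 * p + 1))))"
proof -
  \<comment> \<open>\<open>K / 2\<close> exceeds \<open>4096 C\<^sub>A\<^sup>2 C\<^sub>\<mu>\<^sup>2\<close>, so that the variance at the level \<open>m\<close> chosen below exceeds the assumed risk\<close>
  define K where "K = 2 * (1 + 4096 * C\<^sub>A\<^sup>2 * C\<^sub>\<mu>\<^sup>2)"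
  have K: "K \<ge> 2" by (simp add: K_def)
  define c where "c = (2 * K) powr (- \<alpha>) / (4 * C\<^sub>A)"
  have c: "c > 0" using K assms(1) by (simp add: c_def)
  have CA: "C\<^sub>A > 0" using assms(1) by simp
  have main: "\<exists>\<mu>'\<in>sobolev_ellipsoid \<alpha> R' D.
         risk D \<delta> lam \<mu>' \<tau> \<ge>
           c * R' * min ((inverse R' * \<delta> * real D powr (1 / 4)) powr (2 * \<alpha> / (2 * \<alpha> + 2 * p)))
                         ((inverse R * \<delta>) powr (2 * \<alpha> / (2 * \<beta> + 2 * p + 1)))"
    if \<delta>: "\<delta> > 0" and lam: "\<forall>i\<in>{1..D}. lam i > 0"
      and decay: "\<forall>i\<in>{1..D}. inverse C\<^sub>A * real i powr (- p) \<le> lam i \<and> lam i \<le> C\<^sub>A * real i powr (- p)"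
      and R: "R > 0" and \<beta>: "\<alpha> \<le> \<beta>" and R': "R' \<ge> 2 * R" and \<tau>: "residual_rule D \<tau>"
      and \<mu>: "\<mu> \<in> sobolev_ellipsoid \<beta> R D" "risk D \<delta> lam \<mu> \<tau> \<le> C\<^sub>\<mu> * minimax_rate \<beta> p R \<delta>"
      and noise: "inverse R * \<delta> \<le> 1" and D: "real D \<ge> 4 * K * time_scale (\<alpha> - 1 / 4) p R' \<delta>"
    for D :: nat and \<delta> lam \<beta> R R' \<tau> \<mu>
  proof -
    define y z where "y = inverse R' * \<delta>" and "z = inverse R * \<delta>"
    have R'0: "R' > 0" using R R' by simp
    have yz: "0 < y" "y \<le> z" "z \<le> 1"
      using R R' \<delta> noise by (auto simp: y_def z_def intro!: mult_right_mono le_imp_inverse_le)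
    have expo: "- 2 / (2 * (\<alpha> - 1 / 4) + 2 * p + 1) = - 1 / (\<alpha> + p + 1 / 4)"
      using assms by (simp add: divide_simps)
    have "4 * K * y powr (- 1 / (\<alpha> + p + 1 / 4)) \<le> real D"
      using D unfolding time_scale_def expo y_def .
    then obtain m :: nat where m: "1 \<le> m" "2 * m \<le> D"
      and m_var: "K * z powr (- 2 / (2 * \<beta> + 2 * p + 1)) \<le> real m"
      and m_dim: "real m powr (- (\<alpha> + p)) \<le> y * real D powr (1 / 4)"
      and m_rate: "(2 * K) powr (- \<alpha>) * min ((y * real D powr (1 / 4)) powr (2 * \<alpha> / (2 * \<alpha> + 2 * p)))
        (z powr (2 * \<alpha> / (2 * \<beta> + 2 * p + 1))) \<le> real m powr (- \<alpha>)"
      using truncation_level[of \<alpha> \<beta> p K y z D] assms \<beta> K yz by auto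
    have mD: "m \<in> {1..D}" "m < D" using m by auto
    \<comment> \<open>the maximal spike at \<open>m\<close> up to a constant; \<open>\<mu>'\<close> is chosen so that its energy adds to that of \<open>\<mu> m\<close>\<close>
    define \<rho> where "\<rho> = R' * real m powr (- \<alpha>) / (2 * C\<^sub>A)"
    have \<rho>0: "\<rho> \<ge> 0" using R'0 CA by (simp add: \<rho>_def)
    define \<mu>' where "\<mu>' = \<mu>(m := sqrt ((\<mu> m)\<^sup>2 + \<rho>\<^sup>2))"
    have \<mu>'m: "(\<mu>' m)\<^sup>2 = (\<mu> m)\<^sup>2 + \<rho>\<^sup>2" by (simp add: \<mu>'_def)
    define h where "h = lam m * \<rho> / \<delta>"
    have lam_m: "0 < lam m" "lam m \<le> C\<^sub>A * real m powr (- p)" using lam decay mD by auto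

    have ell: "\<mu>' \<in> sobolev_ellipsoid \<alpha> R' D"
    proof -
      have "(\<Sum>i=1..D. real i powr (2 * \<alpha>) * (\<mu>' i)\<^sup>2)
          = (\<Sum>i=1..D. real i powr (2 * \<alpha>) * (\<mu> i)\<^sup>2) + real m powr (2 * \<alpha>) * \<rho>\<^sup>2"
        using mD by (simp add: sum.remove[of _ m] \<mu>'m distrib_left) (simp add: \<mu>'_def)
      also have "(\<Sum>i=1..D. real i powr (2 * \<alpha>) * (\<mu> i)\<^sup>2) \<le> (\<Sum>i=1..D. real i powr (2 * \<beta>) * (\<mu> i)\<^sup>2)"
        using \<beta> by (intro sum_mono mult_right_mono powr_mono) auto
      also have "\<dots> \<le> R\<^sup>2" using \<mu>(1) by (simp add: sobolev_ellipsoid_def)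
      also have "real m powr (2 * \<alpha>) * \<rho>\<^sup>2 = R'\<^sup>2 / (4 * C\<^sub>A\<^sup>2)"
      proof -
        have "real m powr (2 * \<alpha>) * (real m powr (- \<alpha>))\<^sup>2 = 1"
          using m(1) by (simp add: power2_eq_square powr_add[symmetric])
        then show ?thesis
          by (simp add: \<rho>_def power_divide power_mult_distrib mult.left_commute)
      qed
      also have "R'\<^sup>2 / (4 * C\<^sub>A\<^sup>2) \<le> R'\<^sup>2 / 4"
        using assms(1) by (intro divide_left_mono) auto
      also have "R\<^sup>2 \<le> R'\<^sup>2 / 4"
        using power_mono[of "2 * R" R' 2] R R' by (simp add: power_mult_distrib)
      finally have "(\<Sum>i=1..D. real i powr (2 * \<alpha>) * (\<mu>' i)\<^sup>2) \<le> R'\<^sup>2 / 4 + R'\<^sup>2 / 4" by simp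
      then have "(\<Sum>i=1..D. real i powr (2 * \<alpha>) * (\<mu>' i)\<^sup>2) \<le> R'\<^sup>2"
        using zero_le_power2[of R'] by linarith
      then show ?thesis
        using \<mu>(1) mD(1) by (auto simp: sobolev_ellipsoid_def \<mu>'_def PiE_def extensional_def)
    qed

    have var: "(risk D \<delta> lam \<mu> \<tau>)\<^sup>2 < \<delta>\<^sup>2 * (\<Sum>i=1..m. (inverse (lam i))\<^sup>2) / 4096"
    proof -
      define q where "q = 2 * \<beta> + 2 * p + 1"
      have q: "q > 0" using assms \<beta> by (simp add: q_def)
      define t where "t = z powr (- 2 / q)"
      have z: "z > 0" using yz by simp
      have rate: "(minimax_rate \<beta> p R \<delta>)\<^sup>2 = \<delta>\<^sup>2 * t powr (2 * p + 1)"
      proof -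
        have "(minimax_rate \<beta> p R \<delta>)\<^sup>2 = R\<^sup>2 * z powr (4 * \<beta> / q)"
          by (simp add: minimax_rate_def z_def q_def power_mult_distrib power2_eq_square powr_add[symmetric] add_divide_distrib[symmetric])
        also have "4 * \<beta> / q = 2 + (- 2 / q) * (2 * p + 1)"
          using q by (simp add: q_def field_simps)
        also have "R\<^sup>2 * z powr (2 + (- 2 / q) * (2 * p + 1)) = (R * z)\<^sup>2 * t powr (2 * p + 1)"
          unfolding powr_add[of z 2] t_def powr_powr power_mult_distrib using z by simp
        also have "R * z = \<delta>" using R by (simp add: z_def)
        finally show ?thesis .
      qed
      have t0: "t > 0" using z by (simp add: t_def)
      have risk0: "risk D \<delta> lam \<mu> \<tau> \<ge> 0"
        by (simp add: risk_def)
      have "(risk D \<delta> lam \<mu> \<tau>)\<^sup>2 \<le> C\<^sub>\<mu>\<^sup>2 * (\<delta>\<^sup>2 * t powr (2 * p + 1))"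
        using power_mono[OF \<mu>(2) risk0, of 2] by (simp add: power_mult_distrib rate)
      also have "\<dots> < \<delta>\<^sup>2 * (((K / 2) * t powr (2 * p + 1)) / (C\<^sub>A\<^sup>2 * 4096))"
      proof -
        have "C\<^sub>\<mu>\<^sup>2 < (K / 2) / (C\<^sub>A\<^sup>2 * 4096)"
          using CA by (simp add: K_def field_simps)
        then have "C\<^sub>\<mu>\<^sup>2 * (\<delta>\<^sup>2 * t powr (2 * p + 1)) < (K / 2) / (C\<^sub>A\<^sup>2 * 4096) * (\<delta>\<^sup>2 * t powr (2 * p + 1))"
          using \<delta> t0 by (intro mult_strict_right_mono) auto
        then show ?thesis by (simp add: mult_ac)
      qed
      also have "(K / 2) * t powr (2 * p + 1) \<le> (\<Sum>i=1..m. real i powr (2 * p))"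
      proof -
        have "(K / 2) powr 1 \<le> (K / 2) powr (2 * p + 1)"
          using K assms by (intro powr_mono) auto
        then have "(K / 2) * t powr (2 * p + 1) \<le> (K / 2) powr (2 * p + 1) * t powr (2 * p + 1)"
          using K by (intro mult_right_mono) auto
        also have "\<dots> = (K * t / 2) powr (2 * p + 1)"
          using K t0 by (simp add: powr_mult[symmetric])
        also have "\<dots> \<le> (real m / 2) powr (2 * p + 1)"
          using m_var K t0 assms by (intro powr_mono2) (auto simp: t_def q_def)
        also have "\<dots> \<le> (\<Sum>i=1..m. real i powr (2 * p))"
          using assms by (intro sum_powr_ge) auto
        finally show ?thesis .
      qed
      also have "(\<Sum>i=1..m. real i powr (2 * p)) \<le> (\<Sum>i=1..m. C\<^sub>A\<^sup>2 * (inverse (lam i))\<^sup>2)"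
      proof (rule sum_mono)
        fix i assume i: "i \<in> {1..m}"
        then have l: "lam i > 0" "lam i \<le> C\<^sub>A * real i powr (- p)" using lam decay mD by auto
        have "real i powr p * lam i \<le> real i powr p * (C\<^sub>A * real i powr (- p))"
          using l by (intro mult_left_mono) auto
        also have "\<dots> = C\<^sub>A" using i by (simp add: powr_minus)
        finally have "real i powr p \<le> C\<^sub>A * inverse (lam i)"
          using l by (simp add: field_simps)
        then have "(real i powr p)\<^sup>2 \<le> (C\<^sub>A * inverse (lam i))\<^sup>2"
          by (intro power_mono) auto
        then show "real i powr (2 * p) \<le> C\<^sub>A\<^sup>2 * (inverse (lam i))\<^sup>2"
          by (simp only: power_mult_distrib) (simp add: power2_eq_square powr_add[symmetric])
      qed
      finally show ?thesis
        using CA \<delta> by (simp add: divide_right_mono mult_left_mono sum_distrib_left[symmetric])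
    qed

    have energy: "(\<Sum>i=m..D. (lam i * \<mu>' i)\<^sup>2) = (\<Sum>i=m..D. (lam i * \<mu> i)\<^sup>2) + (\<delta> * h)\<^sup>2"
    proof -
      have "(lam m * \<mu>' m)\<^sup>2 = (lam m * \<mu> m)\<^sup>2 + (\<delta> * h)\<^sup>2"
        using \<delta> by (simp add: power_mult_distrib \<mu>'m distrib_left h_def)
      moreover have "(\<Sum>i\<in>{m..D} - {m}. (lam i * \<mu>' i)\<^sup>2) = (\<Sum>i\<in>{m..D} - {m}. (lam i * \<mu> i)\<^sup>2)"
        by (intro sum.cong) (auto simp: \<mu>'_def)
      ultimately show ?thesis
        using mD by (simp add: sum.remove[of "{m..D}" m])
    qed

    have h4: "8 * h ^ 4 \<le> real (D - m)"
    proof -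
      have "h \<le> (C\<^sub>A * real m powr (- p)) * \<rho> / \<delta>"
        unfolding h_def using lam_m \<rho>0 \<delta> by (intro divide_right_mono mult_right_mono) auto
      also have "\<dots> = real m powr (- (\<alpha> + p)) / (2 * y)"
        using CA R'0 \<delta> by (simp add: \<rho>_def y_def powr_add[symmetric] field_simps)
      also have "\<dots> \<le> y * real D powr (1 / 4) / (2 * y)"
        using m_dim yz by (intro divide_right_mono) auto
      also have "\<dots> = real D powr (1 / 4) / 2" using yz by simp
      finally have "h ^ 4 \<le> (real D powr (1 / 4) / 2) ^ 4"
        using lam_m \<rho>0 \<delta> by (intro power_mono) (auto simp: h_def)
      also have "\<dots> = real D / 16"
        using mD by (simp add: power_divide powr_power)
      finally have "8 * h ^ 4 \<le> real D / 2" by simp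
      also have "\<dots> \<le> real (D - m)" using m by (simp add: of_nat_diff)
      finally show ?thesis .
    qed

    have "(\<rho> / 2)\<^sup>2 \<le> (\<Sum>i=m..D. (\<mu>' i)\<^sup>2) / 2"
    proof -
      have "\<rho>\<^sup>2 \<le> (\<mu>' m)\<^sup>2" by (simp add: \<mu>'m)
      also have "\<dots> \<le> (\<Sum>i=m..D. (\<mu>' i)\<^sup>2)"
        using mD by (intro member_le_sum) auto
      finally have "\<rho>\<^sup>2 \<le> (\<Sum>i=m..D. (\<mu>' i)\<^sup>2)" .
      moreover have "(\<rho> / 2)\<^sup>2 = \<rho>\<^sup>2 / 4" by (simp add: power_divide)
      ultimately show ?thesis using zero_le_power2[of \<rho>] by linarith
    qed
    also have "\<dots> \<le> (risk D \<delta> lam \<mu>' \<tau>)\<^sup>2"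
      by (rule risk_lower_bound[OF \<tau> \<delta> _ m(1) mD(2) _ energy h4 var]) (use lam in \<open>auto simp: \<mu>'_def\<close>)
    finally have "\<rho> / 2 \<le> risk D \<delta> lam \<mu>' \<tau>"
      by (rule power2_le_imp_le) (simp add: risk_def)
    moreover have "c * R' * min ((y * real D powr (1 / 4)) powr (2 * \<alpha> / (2 * \<alpha> + 2 * p)))
        (z powr (2 * \<alpha> / (2 * \<beta> + 2 * p + 1))) \<le> \<rho> / 2"
    proof -
      have "R' / (4 * C\<^sub>A) * ((2 * K) powr (- \<alpha>) * min ((y * real D powr (1 / 4)) powr (2 * \<alpha> / (2 * \<alpha> + 2 * p)))
        (z powr (2 * \<alpha> / (2 * \<beta> + 2 * p + 1)))) \<le> R' / (4 * C\<^sub>A) * real m powr (- \<alpha>)"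
        using R'0 CA by (intro mult_left_mono m_rate) auto
      then show ?thesis by (simp add: c_def \<rho>_def mult_ac)
    qed
    ultimately show ?thesis
      using ell unfolding y_def z_def by (intro bexI[of _ \<mu>']) linarith+
  qed
  show ?thesis
    using c K main
    by (intro exI[of _ c] conjI bexI[of _ 1] exI[of _ "4 * K"]) (auto simp del: One_nat_def)
qed

end
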